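(* Let $m\ge2$, let $\mathcal O=(\mathbf o_1,\dots,\mathbf o_m)^t$ and $\widehat{\mathcal O}=(\mathbf o_1,\dots,\mathbf o_{m-1})^t$. If $\mathbf o_m=\mathbf o_j$ for some $1\le j\le m-1$, then $$\Psi(\mathcal O)-\Psi(\widehat{\mathcal O})=\frac12\log\left(1+\frac{\sigma^2\big\langle\mathcal F\widehat{\Gamma}_{\mathrm{post}}\mathcal F^*\widehat{\mathcal O}^*\widehat\Sigma^{-1}e_j,\ \widehat{\mathcal O}^*\widehat\Sigma^{-1}e_j\big\rangle}{2-\sigma^2e_j^t\widehat\Sigma^{-1}e_j}\right),$$ where $e_j\in\mathbb R^{m-1}$ is the $j$-th standard unit vector.
   Context: $\mathcal H_p$ and $\mathcal H_o$ are separable real Hilbert spaces and $\mathcal F:\mathcal H_p\to\mathcal H_o$ is a (bounded) linear operator. A measurement operator with $n$ measurements is $\mathcal O=(\mathbf o_1,\dots,\mathbf o_n)^t\in(\mathcal H_o^* )^n$, acting by $\mathcal Ou=(\mathbf o_1(u),\dots,\mathbf o_n(u))^t$; each $\mathbf o_j$ is identified with its Riesz representative in $\mathcal H_o$, so $\mathcal O^*e_j=\mathbf o_j$. $\Gamma_{\mathrm{pr}}$ is a positive definite covariance operator on $\mathcal H_p$ (Gaussian prior), $\Gamma_{\mathrm{model}}$ is a covariance operator on $\mathcal H_o$ (self-adjoint, positive semidefinite), and $\sigma^2>0$. For a measurement operator $\mathcal O$ with $n$ measurements, $$\Sigma(\mathcal O)=\mathcal O\Gamma_{\mathrm{model}}\mathcal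 O^*+\sigma^2I_n,\qquad \Gamma_{\mathrm{post}}(\mathcal O)=(\Gamma_{\mathrm{pr}}^{-1}+\mathcal F^*\mathcal O^*\Sigma(\mathcal O)^{-1}\mathcal O\mathcal F)^{-1},$$ $$\Psi(\mathcal O)=\tfrac12\log\det\big(I+\Gamma_{\mathrm{pr}}^{1/2}\mathcal F^*\mathcal O^*\Sigma(\mathcal O)^{-1}\mathcal O\mathcal F\Gamma_{\mathrm{pr}}^{1/2}\big).$$ Notation: $\widehat\Sigma:=\Sigma(\widehat{\mathcal O})$ and $\widehat\Gamma_{\mathrm{post}}:=\Gamma_{\mathrm{post}}(\widehat{\mathcal O})$. Inverses of covariance operators in infinite dimensions are understood as densely defined operators. *)

theory Defs
  imports "HOL-Analysis.Analysis" "Jordan_Normal_Form.Gauss_Jordan_Elimination"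
begin

text \<open>
  A separable real Hilbert space is a type of sort \<open>{real_inner, polish_space}\<close>: an inner product
  space whose metric is complete and second countable.  The space of \<open>n\<close> measurement values is
  \<open>carrier_vec n\<close>; both \<open>\<bullet>\<close> and \<open>$\<close> would be ambiguous, so below they denote \<open>inner\<close> and the
  component of a \<open>Matrix.vec\<close>.
\<close>

no_notation scalar_prod (infix \<open>\<bullet>\<close> 70)
no_notation vec_nth (infixl \<open>$\<close> 90)

subsection \<open>Covariance operators\<close>

definition psd_operator :: "('a::real_inner \<Rightarrow>\<^sub>L 'a) \<Rightarrow> bool" where
  "psd_operator T \<longleftrightarrow> (\<forall>x y. T x \<bullet> y = x \<bullet> T y) \<and> (\<forall>x. 0 \<le> T x \<bullet> x)"

definition positive_definite :: "('a::real_inner \<Rightarrow>\<^sub>L 'a) \<Rightarrow> bool" where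
  "positive_definite T \<longleftrightarrow> (\<forall>x. x \<noteq> 0 \<longrightarrow> 0 < T x \<bullet> x)"

definition orthonormal :: "'a::real_inner set \<Rightarrow> bool" where
  "orthonormal B \<longleftrightarrow> (\<forall>e\<in>B. \<forall>f\<in>B. e \<bullet> f = (if e = f then 1 else 0))"

text \<open>
  The covariance operators of Gaussian measures on a Hilbert space are the positive semidefinite
  operators of trace class; for such operators finiteness of the trace is the trace class condition.
\<close>
definition gaussian_covariance :: "('a::real_inner \<Rightarrow>\<^sub>L 'a) \<Rightarrow> bool" where
  "gaussian_covariance T \<longleftrightarrow>
     psd_operator T \<and> (\<forall>B. orthonormal B \<longrightarrow> (\<lambda>e. T e \<bullet> e) summable_on B)"

text \<open>The positive square root; it is unique, so the choice is immaterial.\<close>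
definition psd_sqrt :: "('a::real_inner \<Rightarrow>\<^sub>L 'a) \<Rightarrow> ('a \<Rightarrow>\<^sub>L 'a)" where
  "psd_sqrt T = (SOME S. psd_operator S \<and> S o\<^sub>L S = T)"

subsection \<open>Fredholm determinant\<close>

definition eigenspace :: "('a::real_vector \<Rightarrow> 'a) \<Rightarrow> real \<Rightarrow> 'a set" where
  "eigenspace T \<mu> = {x. T x = \<mu> *\<^sub>R x}"

text \<open>
  \<open>fredholm_det T\<close> is \<open>det (I + T)\<close> for a self-adjoint trace class operator \<open>T\<close>: the product of
  \<open>1 + \<mu>\<close> over the eigenvalues of \<open>T\<close> counted with multiplicity.  The eigenvalue \<open>0\<close>, the only one
  whose multiplicity may be infinite, contributes the factor 1 and is left out.
\<close>
definition fredholm_det :: "('a::real_vector \<Rightarrow> 'a) \<Rightarrow> real" where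
  "fredholm_det T =
     Lim (finite_subsets_at_top {\<mu>. \<mu> \<noteq> 0 \<and> eigenspace T \<mu> \<noteq> {0}})
       (\<lambda>E. \<Prod>\<mu>\<in>E. (1 + \<mu>) ^ dim (eigenspace T \<mu>))"

subsection \<open>Measurement operators\<close>

text \<open>A measurement operator with \<open>n\<close> measurements is a list of \<open>n\<close> bounded linear functionals.\<close>

type_synonym 'o measurement = "('o \<Rightarrow>\<^sub>L real) list"

definition meas_apply :: "'o::real_inner measurement \<Rightarrow> 'o \<Rightarrow> real Matrix.vec" where
  "meas_apply Obs u = Matrix.vec (length Obs) (\<lambda>i. (Obs ! i) u)"

text \<open>
  The adjoint, for arguments in \<open>carrier_vec (length Obs)\<close>.  The library's \<open>adjoint\<close> does not apply
  because \<open>Matrix.vec\<close> is not an inner product space as a type.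
\<close>
definition meas_adjoint :: "'o::real_inner measurement \<Rightarrow> real Matrix.vec \<Rightarrow> 'o" where
  "meas_adjoint Obs v = (THE w. \<forall>u. scalar_prod (meas_apply Obs u) v = u \<bullet> w)"

definition noise_cov ::
  "('o::real_inner \<Rightarrow>\<^sub>L 'o) \<Rightarrow> real \<Rightarrow> 'o measurement \<Rightarrow> real mat" where
  "noise_cov \<Gamma>model \<sigma> Obs =
     (let n = length Obs in
        Matrix.mat n n (\<lambda>(i, k). meas_apply Obs (\<Gamma>model (meas_adjoint Obs (unit_vec n k))) $ i)
        + \<sigma>\<^sup>2 \<cdot>\<^sub>m 1\<^sub>m n)"

definition noise_prec ::
  "('o::real_inner \<Rightarrow>\<^sub>L 'o) \<Rightarrow> real \<Rightarrow> 'o measurement \<Rightarrow> real mat" where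
  "noise_prec \<Gamma>model \<sigma> Obs = the (mat_inverse (noise_cov \<Gamma>model \<sigma> Obs))"

subsection \<open>Posterior covariance and information gain\<close>

text \<open>The data misfit Hessian \<open>F\<^sup>* Obs\<^sup>* \<Sigma>(Obs)\<^sup>-\<^sup>1 Obs F\<close>.\<close>
definition misfit_hessian ::
  "('p::real_inner \<Rightarrow>\<^sub>L 'o::real_inner) \<Rightarrow> ('o \<Rightarrow>\<^sub>L 'o) \<Rightarrow> real \<Rightarrow> 'o measurement \<Rightarrow> 'p \<Rightarrow> 'p" where
  "misfit_hessian F \<Gamma>model \<sigma> Obs x =
     adjoint F (meas_adjoint Obs (noise_prec \<Gamma>model \<sigma> Obs *\<^sub>v meas_apply Obs (F x)))"

text \<open>
  The inverse of the injective operator \<open>\<Gamma>pr\<close> has domain \<open>range \<Gamma>pr\<close>, and this is also the domain of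
  the sum that is inverted here.
\<close>
definition post_cov ::
  "('p::real_inner \<Rightarrow>\<^sub>L 'o::real_inner) \<Rightarrow> ('p \<Rightarrow>\<^sub>L 'p) \<Rightarrow> ('o \<Rightarrow>\<^sub>L 'o) \<Rightarrow> real \<Rightarrow> 'o measurement
    \<Rightarrow> 'p \<Rightarrow> 'p" where
  "post_cov F \<Gamma>pr \<Gamma>model \<sigma> Obs =
     inv_into (range \<Gamma>pr) (\<lambda>x. inv_into UNIV \<Gamma>pr x + misfit_hessian F \<Gamma>model \<sigma> Obs x)"

definition info_gain ::
  "('p::real_inner \<Rightarrow>\<^sub>L 'o::real_inner) \<Rightarrow> ('p \<Rightarrow>\<^sub>L 'p) \<Rightarrow> ('o \<Rightarrow>\<^sub>L 'o) \<Rightarrow> real \<Rightarrow> 'o measurement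
    \<Rightarrow> real" where
  "info_gain F \<Gamma>pr \<Gamma>model \<sigma> Obs =
     1 / 2 * ln (fredholm_det
       (\<lambda>x. psd_sqrt \<Gamma>pr (misfit_hessian F \<Gamma>model \<sigma> Obs (psd_sqrt \<Gamma>pr x))))"

end

theory Submission
  imports Defs "Jordan_Normal_Form.Determinant"
begin

text \<open>
  Repeating a measurement changes the data misfit Hessian \<open>H\<close> by an operator of rank one. If
  \<open>P\<close> denotes the noise precision of the original measurements, \<open>q = P e\<^sub>j\<close> and \<open>w = Obs\<^sup>* q\<close>, the
  new Hessian is \<open>H + c (F\<^sup>* w) \<otimes> (F\<^sup>* w)\<close> with \<open>c = \<sigma>\<^sup>2 / (2 - \<sigma>\<^sup>2 q\<^sub>j)\<close> (lemma
  \<open>misfit_hessian_repeat\<close>). This is block elimination for the enlarged noise covariance: the new row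
  is \<open>(\<Sigma> - \<sigma>\<^sup>2 I) e\<^sub>j\<close>, so the Schur complement is \<open>\<sigma>\<^sup>2 (2 - \<sigma>\<^sup>2 q\<^sub>j)\<close> and the new functional
  differs from its prediction \<open>Obs\<^sup>* P (\<Sigma> - \<sigma>\<^sup>2 I) e\<^sub>j\<close> by \<open>\<sigma>\<^sup>2 w\<close>. The denominator is at least 1
  because \<open>\<Sigma> \<ge> \<sigma>\<^sup>2 I\<close>.

  With \<open>S\<close> the square root of the prior covariance, the information gain is half the logarithm of
  \<open>det (I + T)\<close> for the finite-rank operator \<open>T = S H S\<close>, and the repetition replaces \<open>T\<close> by
  \<open>T + u \<otimes> u\<close> with \<open>u = \<surd>c S F\<^sup>* w\<close>. The matrix determinant lemma for Fredholm determinants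
  (\<open>fredholm_det_add_rank_one\<close>) gives the quotient of the two determinants as
  \<open>1 + \<langle>(I + T)\<^sup>-\<^sup>1 u, u\<rangle>\<close>. Finally \<open>S (I + S H S)\<^sup>-\<^sup>1 S\<close> is the posterior covariance, so that
  \<open>\<langle>(I + T)\<^sup>-\<^sup>1 u, u\<rangle> = c \<langle>F \<Gamma>\<^sub>p\<^sub>o\<^sub>s\<^sub>t F\<^sup>* w, w\<rangle>\<close> (\<open>info_gain_repeat\<close>).

  Two analytic facts support this. The square root is a limit of polynomials in the operator, built
  by an iteration whose convergence is controlled by a scalar sequence. The Fredholm determinant is
  defined through geometric multiplicities of eigenvalues; the spectral theorem for finite-rank
  operators together with \<open>det (1 + A B) = det (1 + B A)\<close> identifies it with the determinant of an
  ordinary matrix (\<open>fredholm_det_eq_det\<close>).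
\<close>

no_notation scalar_prod (infix \<open>\<bullet>\<close> 70)

section \<open>Riesz representation and adjoints\<close>

text \<open>
  The representative is the minimiser of \<open>J x = \<parallel>x\<parallel>\<^sup>2 - 2 f x\<close>. By the parallelogram law every
  minimising sequence is Cauchy, and the first variation of \<open>J\<close> vanishes at the limit.
\<close>
lemma Riesz_representation:
  fixes f :: "'a::{real_inner, complete_space} \<Rightarrow> real"
  assumes "bounded_linear f"
  shows "\<exists>!r. \<forall>x. f x = x \<bullet> r"
proof (rule ex_ex1I)
  interpret f: bounded_linear f by fact
  define J where "J x = x \<bullet> x - 2 * f x" for x
  obtain K where K: "\<And>x. norm (f x) \<le> norm x * K" using f.bounded by blast
  have lower: "- K\<^sup>2 \<le> J x" for x
  proof -
    have "f x \<le> norm x * K" using K[of x] by simp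
    then have "- K\<^sup>2 + (norm x - K)\<^sup>2 \<le> J x"
      by (simp add: J_def power2_eq_square algebra_simps flip: power2_norm_eq_inner)
    then show ?thesis using zero_le_power2[of "norm x - K"] by linarith
  qed
  then have bdd: "bdd_below (range J)" by (auto simp: bdd_below_def)
  define d where "d = (INF x. J x)"
  have dle: "d \<le> J x" for x unfolding d_def using bdd by (rule cINF_lower) simp
  have "\<exists>x. J x < d + 1 / real (Suc n)" for n
    using cINF_less_iff[of UNIV J "d + 1 / real (Suc n)"] bdd by (auto simp: d_def)
  then obtain X where X: "\<And>n. J (X n) < d + 1 / real (Suc n)" by metis
  have parallelogram: "(norm (x - y))\<^sup>2 \<le> 2 * (J x - d) + 2 * (J y - d)" for x y
  proof -
    have "J x + J y = 2 * J ((1/2) *\<^sub>R (x + y)) + 1/2 * (norm (x - y))\<^sup>2"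
      unfolding J_def f.scaleR f.add power2_norm_eq_inner
      by (simp add: inner_simps inner_commute algebra_simps)
    then show ?thesis using dle[of "(1/2) *\<^sub>R (x + y)"] by argo
  qed
  have "Cauchy X"
  proof (rule metric_CauchyI)
    fix e :: real assume "0 < e"
    \<comment> \<open>beyond index \<open>N\<close> the parallelogram inequality bounds squared distances by \<open>4 / (N + 1)\<close>\<close>
    then obtain N where N: "4 / real (Suc N) < e\<^sup>2"
      using reals_Archimedean[of "e\<^sup>2 / 4"] by (auto simp: field_simps)
    have "dist (X m) (X n) < e" if "N \<le> m" "N \<le> n" for m n
    proof -
      have "1 / real (Suc m) \<le> 1 / real (Suc N)" "1 / real (Suc n) \<le> 1 / real (Suc N)"
        using that by (auto simp: field_simps)
      then have "(norm (X m - X n))\<^sup>2 < e\<^sup>2"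
        using parallelogram[of "X m" "X n"] X[of m] X[of n] N by argo
      then show ?thesis using \<open>0 < e\<close> by (simp add: dist_norm power_less_imp_less_base)
    qed
    then show "\<exists>N. \<forall>m\<ge>N. \<forall>n\<ge>N. dist (X m) (X n) < e" by blast
  qed
  then obtain r where r: "X \<longlonglongrightarrow> r" using Cauchy_convergent convergent_def by blast
  have "(\<lambda>n. J (X n)) \<longlonglongrightarrow> J r"
    unfolding J_def by (intro tendsto_intros r f.tendsto)
  moreover have "(\<lambda>n. J (X n)) \<longlonglongrightarrow> d"
  proof (rule real_tendsto_sandwich[where f = "\<lambda>n. d" and h = "\<lambda>n. d + 1 / real (Suc n)"])
    show "(\<lambda>n. d + 1 / real (Suc n)) \<longlonglongrightarrow> d"
      using tendsto_add[OF tendsto_const[of d] LIMSEQ_inverse_real_of_nat]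
      by (simp add: inverse_eq_divide)
    show "(\<lambda>n. d) \<longlonglongrightarrow> d" by (rule tendsto_const)
    show "\<forall>\<^sub>F n in sequentially. d \<le> J (X n)" using dle by simp
    show "\<forall>\<^sub>F n in sequentially. J (X n) \<le> d + 1 / real (Suc n)"
      using X by (intro always_eventually allI less_imp_le)
  qed
  ultimately have Jr: "J r = d" by (rule LIMSEQ_unique)
  have "f y = y \<bullet> r" for y
  proof (rule ccontr)
    define a where "a = f y - y \<bullet> r"
    assume "f y \<noteq> y \<bullet> r"
    then have a: "a \<noteq> 0" by (simp add: a_def)
    then have y: "0 < y \<bullet> y" by (auto simp: a_def f.zero)
    \<comment> \<open>the minimiser of \<open>J\<close> on the line through \<open>r\<close> in direction \<open>y\<close>\<close>
    define t where "t = a / (y \<bullet> y)"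
    have "J (r + t *\<^sub>R y) = J r - 2 * t * a + t\<^sup>2 * (y \<bullet> y)"
      by (simp add: J_def a_def f.add f.scaleR inner_add_left inner_add_right inner_commute[of r y]
          algebra_simps power2_eq_square)
    also have "\<dots> = J r - a\<^sup>2 / (y \<bullet> y)"
      using y by (simp add: t_def field_simps power2_eq_square)
    also have "\<dots> < J r" using a y by simp
    finally show False using dle[of "r + t *\<^sub>R y"] Jr by simp
  qed
  then show "\<exists>r. \<forall>x. f x = x \<bullet> r" by blast
next
  fix r s assume "\<forall>x. f x = x \<bullet> r" "\<forall>x. f x = x \<bullet> s"
  then have "\<forall>x. x \<bullet> r = x \<bullet> s" by simp
  then show "r = s" by (simp only: vector_eq_ldot)
qed

lemma inner_adjoint:
  fixes F :: "'a::{real_inner, complete_space} \<Rightarrow>\<^sub>L 'b::real_inner"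
  shows "F x \<bullet> y = x \<bullet> adjoint F y"
proof -
  have "\<exists>r. \<forall>x. F x \<bullet> y = x \<bullet> r" for y
    by (intro ex1_implies_ex Riesz_representation bounded_linear_intros)
  then have "\<exists>G. \<forall>x y. F x \<bullet> y = x \<bullet> G y" by metis
  then show ?thesis unfolding adjoint_def by (rule someI2_ex) blast
qed

lemma bounded_linear_adjoint:
  fixes F :: "'a::{real_inner, complete_space} \<Rightarrow>\<^sub>L 'b::real_inner"
  shows "bounded_linear (adjoint F)"
proof (rule bounded_linear_intro[where K = "norm F"])
  show "adjoint F (x + y) = adjoint F x + adjoint F y" for x y
    by (rule vector_eq_ldot[THEN iffD1]) (simp add: inner_add_right flip: inner_adjoint)
  show "adjoint F (c *\<^sub>R x) = c *\<^sub>R adjoint F x" for c x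
    by (rule vector_eq_ldot[THEN iffD1]) (simp flip: inner_adjoint)
  show "norm (adjoint F y) \<le> norm y * norm F" for y
  proof -
    have "norm (adjoint F y) * norm (adjoint F y) = F (adjoint F y) \<bullet> y"
      by (simp add: inner_adjoint flip: power2_norm_eq_inner power2_eq_square)
    also have "\<dots> \<le> norm (F (adjoint F y)) * norm y" by (rule norm_cauchy_schwarz)
    also have "\<dots> \<le> norm F * norm (adjoint F y) * norm y"
      by (intro mult_right_mono norm_blinfun) simp
    finally have "norm (adjoint F y) * norm (adjoint F y) \<le> (norm y * norm F) * norm (adjoint F y)"
      by (simp add: mult_ac)
    then show ?thesis
      by (cases "adjoint F y = 0") (auto simp: mult_le_cancel_right)
  qed
qed

section \<open>Square roots of positive semidefinite operators\<close>

lemma psd_operator_sym: "psd_operator T \<Longrightarrow> T x \<bullet> y = x \<bullet> T y"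
  and psd_operator_nonneg: "psd_operator T \<Longrightarrow> 0 \<le> T x \<bullet> x"
  by (auto simp: psd_operator_def)

text \<open>
  Positivity is only required on the plane spanned by \<open>x\<close> and \<open>y\<close>, so that the inequality also
  applies to operators that are positive on an invariant subspace.
\<close>
lemma psd_Cauchy_Schwarz:
  fixes T :: "'a::real_inner \<Rightarrow> 'a"
  assumes "linear T" and sym: "T x \<bullet> y = x \<bullet> T y"
    and psd: "\<And>s t. 0 \<le> T (s *\<^sub>R x + t *\<^sub>R y) \<bullet> (s *\<^sub>R x + t *\<^sub>R y)"
  shows "(T x \<bullet> y)\<^sup>2 \<le> (T x \<bullet> x) * (T y \<bullet> y)"
proof -
  interpret linear T by fact
  have q: "0 \<le> s\<^sup>2 * (T x \<bullet> x) + 2 * s * t * (T x \<bullet> y) + t\<^sup>2 * (T y \<bullet> y)" for s t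
    using psd[of s t] sym
    by (simp add: add scale inner_simps inner_commute algebra_simps power2_eq_square)
  have x: "0 \<le> T x \<bullet> x" and y: "0 \<le> T y \<bullet> y" using q[of 1 0] q[of 0 1] by simp_all
  show ?thesis
  proof (cases "T y \<bullet> y = 0")
    case True
    have "0 \<le> (T x \<bullet> x) - 2 * t * (T x \<bullet> y)" for t using q[of 1 "-t"] True by simp
    \<comment> \<open>an affine function of \<open>t\<close> that is bounded below is constant; at this \<open>t\<close> it would be \<open>-1\<close>\<close>
    from this[of "(T x \<bullet> x + 1) / (2 * (T x \<bullet> y))"] have "T x \<bullet> y = 0" by (cases "T x \<bullet> y = 0") auto
    then show ?thesis using True by simp
  next
    case False
    with y have pos: "0 < T y \<bullet> y" by simp
    have "0 \<le> (T y \<bullet> y) * ((T x \<bullet> x) * (T y \<bullet> y) - (T x \<bullet> y)\<^sup>2)"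
      using q[of "T y \<bullet> y" "- (T x \<bullet> y)"] by (simp add: algebra_simps power2_eq_square)
    then show ?thesis using pos by (simp add: zero_le_mult_iff)
  qed
qed

text \<open>
  If \<open>2 Y = A + Y\<^sup>2\<close> then \<open>(1 - Y)\<^sup>2 = 1 - A\<close>: a solution is a square root in disguise. The iterates
  \<open>Y\<^sub>n\<^sub>+\<^sub>1 = (A + Y\<^sub>n\<^sup>2) / 2\<close> are dominated by the scalar iteration for \<open>A = 1\<close>, in the sense that
  \<open>\<parallel>Y\<^sub>n\<^sub>+\<^sub>1 - Y\<^sub>n\<parallel> \<le> y\<^sub>n\<^sub>+\<^sub>1 - y\<^sub>n\<close>. The scalar sequence is increasing and bounded by 1, hence Cauchy.
\<close>
lemma psd_operator_sqrt_fixpoint: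
  fixes A :: "'a::{real_inner, complete_space} \<Rightarrow>\<^sub>L 'a"
  assumes sym: "\<And>x y. A x \<bullet> y = x \<bullet> A y" and A1: "norm A \<le> 1"
  shows "\<exists>Y. (\<forall>x y. blinfun_apply Y x \<bullet> y = x \<bullet> blinfun_apply Y y) \<and> norm Y \<le> 1 \<and>
     2 *\<^sub>R Y = A + (Y o\<^sub>L Y)"
proof -
  define Y where "Y = rec_nat (0 :: 'a \<Rightarrow>\<^sub>L 'a) (\<lambda>_ Z. (1/2) *\<^sub>R (A + (Z o\<^sub>L Z)))"
  have Y0: "Y 0 = 0" and YS: "Y (Suc n) = (1/2) *\<^sub>R (A + (Y n o\<^sub>L Y n))" for n
    by (simp_all add: Y_def)
  define y where "y = rec_nat (0 :: real) (\<lambda>_ z. (1/2) * (1 + z * z))"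
  have y0: "y 0 = 0" and yS: "y (Suc n) = (1/2) * (1 + y n * y n)" for n
    by (simp_all add: y_def)
  have y_range: "0 \<le> y n \<and> y n \<le> 1" for n
  proof (induction n)
    case (Suc n)
    then have "y n * y n \<le> 1 * 1" by (intro mult_mono) auto
    then show ?case using Suc by (simp add: yS)
  qed (simp add: y0)
  have Y_le: "norm (Y n) \<le> y n" for n
  proof (induction n)
    case (Suc n)
    have "norm (Y n o\<^sub>L Y n) \<le> norm (Y n) * norm (Y n)" by (rule norm_blinfun_compose)
    also have "\<dots> \<le> y n * y n" using Suc y_range[of n] by (intro mult_mono) auto
    finally have "norm (A + (Y n o\<^sub>L Y n)) \<le> 1 + y n * y n"
      using A1 norm_triangle_ineq[of A "Y n o\<^sub>L Y n"] by linarith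
    then show ?case by (simp add: YS yS)
  qed (simp add: y0 Y0)
  have Y_step: "norm (Y (Suc n) - Y n) \<le> y (Suc n) - y n" for n
  proof (induction n)
    case 0
    show ?case using A1 by (simp add: YS Y0 y0 yS)
  next
    case (Suc n)
    let ?D = "Y (Suc n) - Y n"
    \<comment> \<open>\<open>Y\<^sup>2 - Z\<^sup>2 = Y (Y - Z) + (Y - Z) Z\<close> holds for operators that do not commute\<close>
    have "Y (Suc (Suc n)) - Y (Suc n) = (1/2) *\<^sub>R ((Y (Suc n) o\<^sub>L ?D) + (?D o\<^sub>L Y n))"
      unfolding YS[of "Suc n"] YS[of n]
      by (rule blinfun_eqI) (simp add: blinfun.bilinear_simps algebra_simps)
    moreover have "norm (Y (Suc n) o\<^sub>L ?D) \<le> y (Suc n) * (y (Suc n) - y n)"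
      by (rule order_trans[OF norm_blinfun_compose])
        (use Y_le[of "Suc n"] Suc y_range[of "Suc n"] in \<open>auto intro!: mult_mono\<close>)
    moreover have "norm (?D o\<^sub>L Y n) \<le> (y (Suc n) - y n) * y n"
      by (rule order_trans[OF norm_blinfun_compose])
        (rule mult_mono[OF Suc Y_le order_trans[OF norm_ge_zero Suc] norm_ge_zero])
    moreover note norm_triangle_ineq[of "Y (Suc n) o\<^sub>L ?D" "?D o\<^sub>L Y n"]
    ultimately have "norm (Y (Suc (Suc n)) - Y (Suc n))
        \<le> (1/2) * (y (Suc n) * (y (Suc n) - y n) + (y (Suc n) - y n) * y n)"
      by simp
    also have "\<dots> = y (Suc (Suc n)) - y (Suc n)"
      unfolding yS[of "Suc n"] yS[of n] by (simp add: field_simps)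
    finally show ?case .
  qed
  have Y_diff: "norm (Y (n + k) - Y n) \<le> y (n + k) - y n" for n k
  proof (induction k)
    case (Suc k)
    then show ?case
      using Y_step[of "n + k"] norm_triangle_ineq[of "Y (Suc (n + k)) - Y (n + k)" "Y (n + k) - Y n"]
      by simp
  qed simp
  have "incseq y" by (rule incseq_SucI) (use Y_step order_trans[OF norm_ge_zero] in force)
  then obtain l where "y \<longlonglongrightarrow> l" using incseq_convergent[of y 1] y_range by blast
  then have "Cauchy y" by (intro convergent_Cauchy convergentI)
  have Cauchy_Y: "Cauchy (\<lambda>n. Y n x)" for x
  proof (rule metric_CauchyI)
    fix e :: real assume "0 < e"
    then have "0 < e / (1 + norm x)" by (simp add: add_pos_nonneg)
    then obtain N where N: "\<And>m n. N \<le> m \<Longrightarrow> N \<le> n \<Longrightarrow> dist (y m) (y n) < e / (1 + norm x)"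
      using metric_CauchyD[OF \<open>Cauchy y\<close>] by blast
    have *: "dist (Y (n + k) x) (Y n x) < e" if "N \<le> n" for n k
    proof -
      have "dist (Y (n + k) x) (Y n x) \<le> norm (Y (n + k) - Y n) * norm x"
        by (metis dist_norm norm_blinfun blinfun.diff_left)
      also have "\<dots> \<le> norm (Y (n + k) - Y n) * (1 + norm x)"
        by (intro mult_left_mono) auto
      also have "\<dots> < e"
      proof -
        have "norm (Y (n + k) - Y n) < e / (1 + norm x)"
          using Y_diff[of n k] N[of "n + k" n] that by (simp add: dist_real_def)
        then show ?thesis by (simp add: pos_less_divide_eq add_pos_nonneg)
      qed
      finally show ?thesis .
    qed
    have "dist (Y m x) (Y n x) < e" if "N \<le> m" "N \<le> n" for m n
      using *[of n "m - n"] *[of m "n - m"] that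
      by (cases "n \<le> m") (auto simp: dist_commute)
    then show "\<exists>N. \<forall>m\<ge>N. \<forall>n\<ge>N. dist (Y m x) (Y n x) < e" by blast
  qed
  have "\<exists>l. (\<lambda>n. Y n x) \<longlonglongrightarrow> l" for x
    using Cauchy_convergent[OF Cauchy_Y[of x]] by (simp add: convergent_def)
  then obtain L where L: "\<And>x. (\<lambda>n. Y n x) \<longlonglongrightarrow> L x" by metis
  have Y_contr: "norm (Y n x) \<le> norm x" for n x
  proof -
    have "norm (Y n x) \<le> norm (Y n) * norm x" by (rule norm_blinfun)
    also have "\<dots> \<le> 1 * norm x"
      using Y_le[of n] y_range[of n] by (intro mult_right_mono) auto
    finally show ?thesis by simp
  qed
  have L_contr: "norm (L x) \<le> norm x" for x
    by (rule LIMSEQ_le_const2[OF tendsto_norm[OF L]]) (use Y_contr in auto)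
  have L_bl: "bounded_linear L"
  proof (rule bounded_linear_intro[where K = 1])
    show "L (x + z) = L x + L z" for x z
      by (rule LIMSEQ_unique[OF L]) (simp add: blinfun.add_right tendsto_add L)
    show "L (c *\<^sub>R x) = c *\<^sub>R L x" for c x
      by (rule LIMSEQ_unique[OF L]) (simp add: blinfun.scaleR_right tendsto_scaleR L)
  qed (use L_contr in simp)
  have L_diff: "L (x - z) = L x - L z" for x z
    using L_bl by (simp add: bounded_linear.linear linear_diff)
  have Y_sym: "Y n x \<bullet> z = x \<bullet> Y n z" for n x z
    by (induction n arbitrary: x z)
       (simp_all add: Y0 YS blinfun.bilinear_simps inner_add_left inner_add_right sym)
  have L_sym: "L x \<bullet> z = x \<bullet> L z" for x z
  proof (rule LIMSEQ_unique)
    show "(\<lambda>n. Y n x \<bullet> z) \<longlonglongrightarrow> L x \<bullet> z" by (intro tendsto_intros L)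
    show "(\<lambda>n. Y n x \<bullet> z) \<longlonglongrightarrow> x \<bullet> L z" unfolding Y_sym by (intro tendsto_intros L)
  qed
  have L_eq: "2 *\<^sub>R L x = A x + L (L x)" for x
  proof (rule LIMSEQ_unique)
    have "(\<lambda>n. Y (Suc n) x) \<longlonglongrightarrow> L x" using L by (rule LIMSEQ_Suc)
    then show "(\<lambda>n. 2 *\<^sub>R Y (Suc n) x) \<longlonglongrightarrow> 2 *\<^sub>R L x" by (intro tendsto_intros)
    have "(\<lambda>n. Y n (Y n x - L x)) \<longlonglongrightarrow> 0"
    proof (rule Lim_null_comparison)
      show "\<forall>\<^sub>F n in sequentially. norm (Y n (Y n x - L x)) \<le> norm (Y n x - L x)"
        by (simp add: Y_contr)
      show "(\<lambda>n. norm (Y n x - L x)) \<longlonglongrightarrow> 0"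
        using L[of x] by (simp add: LIM_zero tendsto_norm_zero)
    qed
    from tendsto_add[OF this L[of "L x"]] have "(\<lambda>n. Y n (Y n x)) \<longlonglongrightarrow> L (L x)"
      by (simp add: blinfun.diff_right)
    then show "(\<lambda>n. 2 *\<^sub>R Y (Suc n) x) \<longlonglongrightarrow> A x + L (L x)"
      by (simp add: YS blinfun.bilinear_simps tendsto_add)
  qed
  have "norm (Blinfun L) \<le> 1"
    by (rule norm_blinfun_bound) (simp_all add: bounded_linear_Blinfun_apply[OF L_bl] L_contr)
  moreover have "2 *\<^sub>R Blinfun L = A + (Blinfun L o\<^sub>L Blinfun L)"
    by (rule blinfun_eqI) (simp add: bounded_linear_Blinfun_apply[OF L_bl] blinfun.bilinear_simps L_eq)
  ultimately show ?thesis
    using L_sym by (intro exI[of _ "Blinfun L"]) (simp add: bounded_linear_Blinfun_apply[OF L_bl])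
qed

text \<open>
  After scaling \<open>T\<close> to norm below 1, \<open>A = 1 - T\<close> is a contraction by the Cauchy-Schwarz inequality for
  the form of \<open>T\<close>. The root \<open>1 - Y\<close> is positive because \<open>\<parallel>Y\<parallel> \<le> 1\<close>.
\<close>
lemma psd_operator_has_sqrt:
  fixes T :: "'a::{real_inner, complete_space} \<Rightarrow>\<^sub>L 'a"
  assumes "psd_operator T"
  shows "\<exists>S. psd_operator S \<and> S o\<^sub>L S = T"
proof -
  have sym: "T x \<bullet> y = x \<bullet> T y" and psd: "0 \<le> T x \<bullet> x" for x y
    using assms by (auto simp: psd_operator_def)
  \<comment> \<open>adding 1 keeps \<open>k\<close> positive when \<open>T = 0\<close>\<close>
  define k where "k = norm T + 1"
  have k: "0 < k" by (simp add: k_def add_nonneg_pos)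
  define A where "A = id_blinfun - (1 / k) *\<^sub>R T"
  have A: "A x = x - (1 / k) *\<^sub>R T x" for x by (simp add: A_def blinfun.bilinear_simps)
  have A_sym: "A x \<bullet> y = x \<bullet> A y" for x y by (simp add: A inner_diff_left inner_diff_right sym)
  have "norm (A x) \<le> 1 * norm x" for x
  proof -
    have "T (T x) \<bullet> T x \<le> norm (T (T x)) * norm (T x)" by (rule norm_cauchy_schwarz)
    also have "\<dots> \<le> (norm T * norm (T x)) * norm (T x)"
      by (intro mult_right_mono norm_blinfun) simp
    also have "\<dots> \<le> k * (T x \<bullet> T x)"
      by (simp add: k_def power2_norm_eq_inner[symmetric] power2_eq_square algebra_simps)
    finally have TT: "T (T x) \<bullet> T x \<le> k * (T x \<bullet> T x)" .
    have "(T x \<bullet> T x)\<^sup>2 \<le> (T x \<bullet> x) * (T (T x) \<bullet> T x)"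
      by (intro psd_Cauchy_Schwarz bounded_linear.linear blinfun.bounded_linear_right sym psd)
    also have "\<dots> \<le> (T x \<bullet> x) * (k * (T x \<bullet> T x))" using TT psd by (rule mult_left_mono)
    finally have "(T x \<bullet> T x) * (T x \<bullet> T x) \<le> (k * (T x \<bullet> x)) * (T x \<bullet> T x)"
      by (simp add: power2_eq_square mult_ac)
    then have Tx: "T x \<bullet> T x \<le> k * (T x \<bullet> x)"
      using psd[of x] k by (cases "T x = 0") (auto simp: mult_le_cancel_right)
    have "(norm (A x))\<^sup>2 = x \<bullet> x - (2 / k) * (T x \<bullet> x) + (1 / k)\<^sup>2 * (T x \<bullet> T x)"
      unfolding A power2_norm_eq_inner inner_diff_left inner_diff_right inner_commute[of x "T x"]
        inner_scaleR_left inner_scaleR_right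
      using k by (simp add: power2_eq_square field_simps)
    also have "\<dots> \<le> x \<bullet> x - (2 / k) * (T x \<bullet> x) + (1 / k)\<^sup>2 * (k * (T x \<bullet> x))"
      using Tx by (intro add_left_mono mult_left_mono) auto
    also have "\<dots> \<le> (norm x)\<^sup>2"
      unfolding power2_norm_eq_inner using psd[of x] k by (simp add: field_simps power2_eq_square)
    finally show ?thesis by (simp add: abs_le_square_iff[symmetric])
  qed
  then have "norm A \<le> 1" by (intro norm_blinfun_bound) auto
  then obtain Y :: "'a \<Rightarrow>\<^sub>L 'a" where Y_sym: "\<And>x y. Y x \<bullet> y = x \<bullet> Y y" and Y1: "norm Y \<le> 1"
    and Y_eq: "2 *\<^sub>R Y = A + (Y o\<^sub>L Y)"
    using psd_operator_sqrt_fixpoint[of A] A_sym by blast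
  have Y_eq': "2 *\<^sub>R Y x = A x + Y (Y x)" for x
    using arg_cong[OF Y_eq, of "\<lambda>Z. blinfun_apply Z x"] by (simp add: blinfun.bilinear_simps)
  define S where "S = sqrt k *\<^sub>R (id_blinfun - Y)"
  have S: "S x = sqrt k *\<^sub>R (x - Y x)" for x by (simp add: S_def blinfun.bilinear_simps)
  have "S (S x) = T x" for x
  proof -
    have "S (S x) = k *\<^sub>R (x - 2 *\<^sub>R Y x + Y (Y x))"
      using k by (simp add: S blinfun.bilinear_simps algebra_simps scaleR_2)
    also have "\<dots> = k *\<^sub>R (x - A x)" by (simp add: Y_eq')
    also have "\<dots> = T x" using k by (simp add: A)
    finally show ?thesis .
  qed
  then have "S o\<^sub>L S = T" by (intro blinfun_eqI) simp
  moreover have "psd_operator S"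
  proof -
    have "Y x \<bullet> x \<le> x \<bullet> x" for x
    proof -
      have "Y x \<bullet> x \<le> norm (Y x) * norm x" by (rule norm_cauchy_schwarz)
      also have "\<dots> \<le> (norm Y * norm x) * norm x" by (intro mult_right_mono norm_blinfun) simp
      also have "\<dots> \<le> (1 * norm x) * norm x" using Y1 by (intro mult_right_mono) auto
      finally show ?thesis by (simp add: power2_norm_eq_inner[symmetric] power2_eq_square)
    qed
    then show ?thesis
      using k by (simp add: psd_operator_def S inner_diff_left inner_diff_right Y_sym)
  qed
  ultimately show ?thesis by blast
qed

lemma
  fixes T :: "'a::{real_inner, complete_space} \<Rightarrow>\<^sub>L 'a"
  assumes "psd_operator T"
  shows psd_operator_psd_sqrt: "psd_operator (psd_sqrt T)"
    and psd_sqrt_psd_sqrt: "psd_sqrt T (psd_sqrt T x) = T x"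
proof -
  have *: "psd_operator (psd_sqrt T) \<and> psd_sqrt T o\<^sub>L psd_sqrt T = T"
    unfolding psd_sqrt_def by (rule someI_ex[OF psd_operator_has_sqrt[OF assms]])
  then show "psd_operator (psd_sqrt T)" by blast
  have "psd_sqrt T (psd_sqrt T x) = (psd_sqrt T o\<^sub>L psd_sqrt T) x" by simp
  then show "psd_sqrt T (psd_sqrt T x) = T x" using * by simp
qed

section \<open>The spectral theorem for positive semidefinite operators of finite rank\<close>

lemma orthonormal_independent:
  assumes "orthonormal V"
  shows "independent V"
proof (rule pairwise_orthogonal_independent)
  show "pairwise real_inner_class.orthogonal V"
    using assms by (auto simp: orthonormal_def pairwise_def real_inner_class.orthogonal_def)
  show "0 \<notin> V" using assms by (metis inner_zero_left orthonormal_def zero_neq_one)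
qed

lemma orthonormal_expansion:
  assumes "finite V" "orthonormal V" "x \<in> span V"
  shows "x = (\<Sum>v\<in>V. (x \<bullet> v) *\<^sub>R v)"
proof -
  obtain u where x: "x = (\<Sum>v\<in>V. u v *\<^sub>R v)"
    using assms(3) by (auto simp: span_finite[OF assms(1)])
  have "x \<bullet> w = u w" if "w \<in> V" for w
  proof -
    have "x \<bullet> w = (\<Sum>v\<in>V. if v = w then u v else 0)"
      unfolding x inner_sum_left using assms(2) that
      by (intro sum.cong) (auto simp: orthonormal_def)
    then show ?thesis using assms(1) that by simp
  qed
  then show ?thesis using x by simp
qed

lemma orthonormal_Parseval:
  assumes "finite V" "orthonormal V" "x \<in> span V"
  shows "(\<Sum>v\<in>V. (x \<bullet> v) * (y \<bullet> v)) = x \<bullet> y"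
proof -
  have "x \<bullet> y = (\<Sum>v\<in>V. (x \<bullet> v) *\<^sub>R v) \<bullet> y"
    by (rule arg_cong[OF orthonormal_expansion[OF assms], of "\<lambda>w. w \<bullet> y"])
  also have "\<dots> = (\<Sum>v\<in>V. (x \<bullet> v) * (y \<bullet> v))"
    by (simp add: inner_sum_left inner_commute[of y])
  finally show ?thesis by simp
qed

lemma orthonormal_basis_exists:
  fixes A :: "'a::real_inner set"
  assumes "finite A"
  shows "\<exists>V. finite V \<and> orthonormal V \<and> span V = span A"
proof -
  obtain C where C: "finite C" "span C = span A" "pairwise real_inner_class.orthogonal C"
    using basis_orthogonal[OF assms] by blast
  define V where "V = (\<lambda>x. (1 / norm x) *\<^sub>R x) ` (C - {0})"
  have "span V = span (C - {0})"
    unfolding V_def using C(1) by (intro span_image_scale) auto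
  moreover have "orthonormal V"
    unfolding orthonormal_def
  proof (intro ballI)
    fix e f assume "e \<in> V" "f \<in> V"
    then obtain x y where x: "x \<in> C" "x \<noteq> 0" "e = (1 / norm x) *\<^sub>R x"
      and y: "y \<in> C" "y \<noteq> 0" "f = (1 / norm y) *\<^sub>R y"
      by (auto simp: V_def)
    have self: "e \<bullet> e = 1" using x by (simp add: power2_norm_eq_inner[symmetric] power2_eq_square)
    show "e \<bullet> f = (if e = f then 1 else 0)"
    proof (cases "x = y")
      case True
      then show ?thesis using x y self by simp
    next
      case False
      then have "x \<bullet> y = 0" using C(3) x y by (auto simp: pairwise_def real_inner_class.orthogonal_def)
      then have "e \<bullet> f = 0" using x y by simp
      then show ?thesis using self by auto
    qed
  qed
  ultimately show ?thesis using C by (intro exI[of _ V]) (auto simp: V_def)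
qed

text \<open>
  Every vector of norm at most 1 in the span of an orthonormal set has coordinates in \<open>[-1, 1]\<close>, so
  this compact set serves as a substitute for the closed unit ball of a finite-dimensional subspace.
\<close>
lemma compact_bounded_combinations:
  fixes V :: "'a::real_normed_vector set"
  assumes "finite V"
  shows "compact {\<Sum>v\<in>V. c v *\<^sub>R v | c. \<forall>v\<in>V. \<bar>c v\<bar> \<le> (1::real)}"
  using assms
proof induction
  case empty
  then show ?case by simp
next
  case (insert w V)
  let ?C = "\<lambda>V. {\<Sum>v\<in>V. c v *\<^sub>R v | c. \<forall>v\<in>V. \<bar>c v\<bar> \<le> (1::real)}"
  have "?C (insert w V) = (\<lambda>p. fst p *\<^sub>R w + snd p) ` ({-1..1} \<times> ?C V)" (is "_ = ?R")
  proof (intro equalityI subsetI)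
    fix x assume "x \<in> ?C (insert w V)"
    then obtain c where c: "x = (\<Sum>v\<in>insert w V. c v *\<^sub>R v)" "\<forall>v\<in>insert w V. \<bar>c v\<bar> \<le> 1" by blast
    then have "x = c w *\<^sub>R w + (\<Sum>v\<in>V. c v *\<^sub>R v)" "c w \<in> {-1..1}" "\<forall>v\<in>V. \<bar>c v\<bar> \<le> 1"
      using insert by (auto simp: abs_le_iff)
    then show "x \<in> ?R" by (intro image_eqI[of _ _ "(c w, \<Sum>v\<in>V. c v *\<^sub>R v)"]) auto
  next
    fix x assume "x \<in> ?R"
    then obtain t c where x: "x = t *\<^sub>R w + (\<Sum>v\<in>V. c v *\<^sub>R v)" and t: "t \<in> {-1..1}"
      and c: "\<forall>v\<in>V. \<bar>c v\<bar> \<le> 1" by auto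
    have "(\<Sum>v\<in>V. c v *\<^sub>R v) = (\<Sum>v\<in>V. (c(w := t)) v *\<^sub>R v)"
      using insert by (intro sum.cong) auto
    then have "x = (\<Sum>v\<in>insert w V. (c(w := t)) v *\<^sub>R v)"
      using insert by (simp add: x)
    moreover have "\<forall>v\<in>insert w V. \<bar>(c(w := t)) v\<bar> \<le> 1" using c t by (auto simp: abs_le_iff)
    ultimately show "x \<in> ?C (insert w V)" by blast
  qed
  then show ?case
    using insert by (auto intro!: compact_continuous_image continuous_intros compact_Times)
qed

text \<open>
  Finite rank is expressed by a finite spanning set because \<open>dim\<close> is 0 on infinite-dimensional spaces.
\<close>
definition finite_rank_psd :: "('a::real_inner \<Rightarrow> 'a) \<Rightarrow> bool" where
  "finite_rank_psd T \<longleftrightarrow> bounded_linear T \<and> (\<forall>x y. T x \<bullet> y = x \<bullet> T y) \<and> (\<forall>x. 0 \<le> T x \<bullet> x) \<and>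
     (\<exists>A. finite A \<and> range T \<subseteq> span A)"

lemma finite_rank_psdI:
  assumes "bounded_linear T" "\<And>x y. T x \<bullet> y = x \<bullet> T y" "\<And>x. 0 \<le> T x \<bullet> x"
    and "finite A" "range T \<subseteq> span A"
  shows "finite_rank_psd T"
  using assms unfolding finite_rank_psd_def by (intro conjI allI exI[of _ A])

text \<open>
  The Rayleigh quotient attains its maximum \<open>c\<close> on the compact unit sphere of \<open>W \<inter> span V\<close>, where \<open>V\<close>
  spans the range of \<open>T\<close>. At a maximiser \<open>e\<close> the form of \<open>G = c - T\<close>, which is positive on this
  subspace, vanishes, and the Cauchy-Schwarz inequality for that form yields \<open>G e = 0\<close>.
\<close>
lemma finite_rank_psd_eigenvector:
  assumes T: "finite_rank_psd T" and W: "subspace W" "closed W" "\<And>x. x \<in> W \<Longrightarrow> T x \<in> W"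
    and x0: "x0 \<in> W" "T x0 \<noteq> 0"
  shows "\<exists>e\<in>W. \<exists>c>0. norm e = 1 \<and> T e = c *\<^sub>R e"
proof -
  have bl: "bounded_linear T" and sym: "\<And>x y. T x \<bullet> y = x \<bullet> T y" and psd: "\<And>x. 0 \<le> T x \<bullet> x"
    using T by (auto simp: finite_rank_psd_def)
  interpret T: bounded_linear T by fact
  obtain V where V: "finite V" "orthonormal V" "range T \<subseteq> span V"
    using T orthonormal_basis_exists unfolding finite_rank_psd_def by metis
  define C where "C = {\<Sum>v\<in>V. c v *\<^sub>R v | c. \<forall>v\<in>V. \<bar>c v\<bar> \<le> 1}"
  define K where "K = C \<inter> ({x. norm x = 1} \<inter> W)"
  have "compact K"
    unfolding K_def C_def
    using V(1) W(2)
    by (intro compact_Int_closed compact_bounded_combinations closed_Int closed_Collect_eq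
        continuous_intros)
  have C_span: "C \<subseteq> span V" unfolding C_def by (auto intro: span_sum span_scale span_base)
  have in_K: "x \<in> K" if "x \<in> span V" "x \<in> W" "norm x = 1" for x
  proof -
    have "\<forall>v\<in>V. \<bar>x \<bullet> v\<bar> \<le> 1"
    proof
      fix v assume "v \<in> V"
      then have "norm v = 1" using V(2) by (simp add: orthonormal_def norm_eq_sqrt_inner)
      then show "\<bar>x \<bullet> v\<bar> \<le> 1" using Cauchy_Schwarz_ineq2[of x v] that by simp
    qed
    then have "x \<in> C" unfolding C_def using orthonormal_expansion[OF V(1,2) that(1)] by blast
    then show ?thesis using that by (simp add: K_def)
  qed
  have in_K': "(1 / norm x) *\<^sub>R x \<in> K" if "x \<in> span V" "x \<in> W" "x \<noteq> 0" for x
    using that W(1) by (intro in_K) (auto intro: span_scale subspace_scale)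
  have "T x0 \<bullet> T x0 \<noteq> 0" using x0 by simp
  \<comment> \<open>\<open>T x0\<close> replaces \<open>x0\<close> as a witness because it also lies in \<open>span V\<close>\<close>
  then have TTx0: "T (T x0) \<noteq> 0" by (metis sym inner_zero_right)
  have "K \<noteq> {}" using in_K'[of "T x0"] V(3) W(3) x0 by auto
  moreover have "continuous_on K (\<lambda>x. T x \<bullet> x)" by (intro continuous_intros T.continuous_on)
  ultimately have "\<exists>e\<in>K. \<forall>x\<in>K. T x \<bullet> x \<le> T e \<bullet> e"
    by (rule continuous_attains_sup[OF \<open>compact K\<close>])
  then obtain e where e: "e \<in> K" and max: "\<And>x. x \<in> K \<Longrightarrow> T x \<bullet> x \<le> T e \<bullet> e" by blast
  have eW: "e \<in> W" "norm e = 1" "e \<in> span V" using e C_span by (auto simp: K_def)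
  have ee: "e \<bullet> e = 1" using eW(2) by (simp add: norm_eq_1)
  define c where "c = T e \<bullet> e"
  have le_c: "T x \<bullet> x \<le> c * (x \<bullet> x)" if "x \<in> span V" "x \<in> W" for x
  proof (cases "x = 0")
    case False
    have "T ((1 / norm x) *\<^sub>R x) \<bullet> ((1 / norm x) *\<^sub>R x) \<le> c"
      unfolding c_def by (rule max[OF in_K'[OF that False]])
    then have "(T x \<bullet> x) / (norm x)\<^sup>2 \<le> c"
      by (simp add: T.scaleR power2_eq_square)
    then show ?thesis using False by (simp add: pos_divide_le_eq power2_norm_eq_inner)
  qed simp
  define G where "G x = c *\<^sub>R x - T x" for x
  have "linear G" unfolding G_def
    by (intro linear_compose_sub linear_scale_self T.linear)
  have GW: "G e \<in> W" "G e \<in> span V"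
    using eW W V(3) by (auto simp: G_def intro!: subspace_diff subspace_scale span_diff span_scale)
  have "(G e \<bullet> G e)\<^sup>2 \<le> (G e \<bullet> e) * (G (G e) \<bullet> G e)"
  proof (rule psd_Cauchy_Schwarz[OF \<open>linear G\<close>])
    show "G e \<bullet> G e = e \<bullet> G (G e)"
      by (simp add: G_def inner_diff_left inner_diff_right sym T.diff T.scaleR)
    show "0 \<le> G (s *\<^sub>R e + t *\<^sub>R G e) \<bullet> (s *\<^sub>R e + t *\<^sub>R G e)" for s t
    proof -
      have "s *\<^sub>R e + t *\<^sub>R G e \<in> span V" "s *\<^sub>R e + t *\<^sub>R G e \<in> W"
        using eW GW W(1) by (auto intro!: subspace_add subspace_scale span_add span_scale)
      from le_c[OF this] show ?thesis by (simp add: G_def inner_diff_left)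
    qed
  qed
  also have "G e \<bullet> e = 0" by (simp add: G_def inner_diff_left c_def ee)
  finally have "G e = 0" by simp
  then have "T e = c *\<^sub>R e" by (simp add: G_def)
  moreover have "0 < c"
  proof (rule ccontr)
    assume "\<not> 0 < c"
    let ?x = "T x0"
    have "T ?x \<bullet> ?x \<le> c * (?x \<bullet> ?x)" using V(3) W(3) x0 by (intro le_c) auto
    also have "\<dots> \<le> 0" using \<open>\<not> 0 < c\<close> by (simp add: mult_nonpos_nonneg)
    finally have "T ?x \<bullet> ?x = 0" using psd[of ?x] by simp
    moreover have "(T ?x \<bullet> T ?x)\<^sup>2 \<le> (T ?x \<bullet> ?x) * (T (T ?x) \<bullet> T ?x)"
      by (intro psd_Cauchy_Schwarz T.linear sym psd)
    ultimately show False using TTx0 by simp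
  qed
  ultimately show ?thesis using eW by blast
qed

text \<open>
  An orthonormal set of eigenvectors with positive eigenvalues lies in the range, so there is one of
  maximal cardinality. On its orthogonal complement, a closed invariant subspace, \<open>T\<close> must vanish,
  since another eigenvector could be added otherwise.
\<close>
theorem finite_rank_psd_spectral:
  assumes T: "finite_rank_psd T"
  obtains E l where "finite E" "orthonormal E" "\<And>e. e \<in> E \<Longrightarrow> 0 < l e"
    "\<And>e. e \<in> E \<Longrightarrow> T e = l e *\<^sub>R e" "\<And>x. T x = (\<Sum>e\<in>E. (l e * (x \<bullet> e)) *\<^sub>R e)"
proof -
  have bl: "bounded_linear T" and sym: "\<And>x y. T x \<bullet> y = x \<bullet> T y"
    using T by (auto simp: finite_rank_psd_def)
  interpret T: bounded_linear T by fact
  obtain A where A: "finite A" "range T \<subseteq> span A" using T by (auto simp: finite_rank_psd_def)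
  define P where "P E \<longleftrightarrow> finite E \<and> orthonormal E \<and> (\<forall>e\<in>E. \<exists>c>0. T e = c *\<^sub>R e)" for E
  have bound: "card E \<le> card A" if "P E" for E
  proof -
    have "E \<subseteq> span A"
    proof
      fix e assume "e \<in> E"
      with that have "\<exists>c>0. T e = c *\<^sub>R e" by (simp add: P_def)
      then obtain c where "c > 0" "T e = c *\<^sub>R e" by (elim exE conjE)
      then have "e = (1 / c) *\<^sub>R T e" by simp
      also have "\<dots> \<in> span A" using A(2) by (intro span_scale) auto
      finally show "e \<in> span A" .
    qed
    then show ?thesis
      using independent_span_bound[OF A(1)] orthonormal_independent that by (auto simp: P_def)
  qed
  have "P {}" by (simp add: P_def orthonormal_def)
  then have "\<exists>E. P E \<and> (\<forall>E'. P E' \<longrightarrow> card E' \<le> card E)"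
    by (rule ex_has_greatest_nat[where b = "Suc (card A)"]) (simp add: bound less_Suc_eq_le)
  then obtain E where E: "P E" and max: "\<And>E'. P E' \<Longrightarrow> card E' \<le> card E" by blast
  have "\<forall>e\<in>E. \<exists>c. 0 < c \<and> T e = c *\<^sub>R e" using E by (simp add: P_def)
  from bchoice[OF this] obtain l where l: "\<And>e. e \<in> E \<Longrightarrow> 0 < l e \<and> T e = l e *\<^sub>R e" by blast
  have fin: "finite E" and on: "orthonormal E" using E by (auto simp: P_def)
  define W where "W = {x. \<forall>e\<in>E. x \<bullet> e = 0}"
  have subW: "subspace W" by (auto simp: W_def subspace_def inner_add_left)
  have "W = (\<Inter>e\<in>E. {x. x \<bullet> e = 0})" by (auto simp: W_def)
  then have clW: "closed W"
    by (auto intro!: closed_INT closed_Collect_eq continuous_intros)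
  have TW: "T x \<in> W" if "x \<in> W" for x using that l by (simp add: W_def sym)
  have T0: "T x = 0" if "x \<in> W" for x
  proof (rule ccontr)
    assume "T x \<noteq> 0"
    from finite_rank_psd_eigenvector[OF T subW clW TW that this]
    obtain f c where f: "f \<in> W" "c > 0" "norm f = 1" "T f = c *\<^sub>R f" by auto
    have ff: "f \<bullet> f = 1" using f(3) by (simp add: norm_eq_1)
    have "f \<notin> E" using f(1) ff by (auto simp: W_def)
    moreover have "P (insert f E)"
      using E f ff by (auto simp: P_def orthonormal_def W_def inner_commute)
    ultimately show False using max[of "insert f E"] fin by simp
  qed
  have "T x = (\<Sum>e\<in>E. (l e * (x \<bullet> e)) *\<^sub>R e)" for x
  proof -
    have "x - (\<Sum>e\<in>E. (x \<bullet> e) *\<^sub>R e) \<in> W"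
    proof -
      have "(\<Sum>e\<in>E. (x \<bullet> e) *\<^sub>R e) \<bullet> f = x \<bullet> f" if "f \<in> E" for f
      proof -
        have "(\<Sum>e\<in>E. (x \<bullet> e) *\<^sub>R e) \<bullet> f = (\<Sum>e\<in>E. if e = f then x \<bullet> e else 0)"
          unfolding inner_sum_left using on that
          by (intro sum.cong) (auto simp: orthonormal_def)
        then show ?thesis using fin that by simp
      qed
      then show ?thesis by (simp add: W_def inner_diff_left)
    qed
    then have "T (x - (\<Sum>e\<in>E. (x \<bullet> e) *\<^sub>R e)) = 0" by (rule T0)
    then have "T x = (\<Sum>e\<in>E. (x \<bullet> e) *\<^sub>R T e)"
      by (simp add: T.diff T.sum T.scaleR)
    also have "\<dots> = (\<Sum>e\<in>E. (l e * (x \<bullet> e)) *\<^sub>R e)"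
      using l by (intro sum.cong) (auto simp: mult.commute)
    finally show ?thesis .
  qed
  then show ?thesis using fin on l by (intro that) auto
qed

text \<open>
  In an eigenbasis \<open>(1 + T)\<^sup>-\<^sup>1\<close> multiplies the coordinate along \<open>e\<close> by \<open>1 / (1 + l e) = 1 - l e / (1 + l e)\<close>;
  the subtracted part is the finite sum \<open>s\<close> below.
\<close>
lemma finite_rank_psd_resolvent:
  assumes "finite_rank_psd T"
  shows "\<exists>z. z + T z = u"
proof -
  obtain E l where "finite E" "orthonormal E" and pos: "\<And>e. e \<in> E \<Longrightarrow> 0 < l e" and eigen: "\<And>e. e \<in> E \<Longrightarrow> T e = l e *\<^sub>R e"
    and T: "\<And>x. T x = (\<Sum>e\<in>E. (l e * (x \<bullet> e)) *\<^sub>R e)"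
    by (rule finite_rank_psd_spectral[OF assms]) (rule that)
  have lin: "linear T" using assms by (auto simp: finite_rank_psd_def bounded_linear.linear)
  define s where "s = (\<Sum>e\<in>E. (l e / (1 + l e) * (u \<bullet> e)) *\<^sub>R e)"
  have "T s = (\<Sum>e\<in>E. (l e / (1 + l e) * (u \<bullet> e)) *\<^sub>R (l e *\<^sub>R e))"
    unfolding s_def linear_sum[OF lin] linear_scale[OF lin] using eigen by (intro sum.cong) auto
  then have "s + T s = (\<Sum>e\<in>E. (l e / (1 + l e) * (u \<bullet> e)) *\<^sub>R e + (l e / (1 + l e) * (u \<bullet> e)) *\<^sub>R (l e *\<^sub>R e))"
    by (simp add: s_def sum.distrib)
  also have "\<dots> = T u"
    unfolding T[of u]
  proof (intro sum.cong refl)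
    fix e assume "e \<in> E"
    then have "1 + l e \<noteq> 0" using pos[of e] by simp
    then have "l e / (1 + l e) * (u \<bullet> e) + l e / (1 + l e) * (u \<bullet> e) * l e = l e * (u \<bullet> e)"
      by (simp add: divide_simps) (simp add: algebra_simps)
    then show "(l e / (1 + l e) * (u \<bullet> e)) *\<^sub>R e + (l e / (1 + l e) * (u \<bullet> e)) *\<^sub>R (l e *\<^sub>R e)
        = (l e * (u \<bullet> e)) *\<^sub>R e"
      by (simp only: scaleR_scaleR flip: scaleR_add_left)
  qed
  finally have "(u - s) + T (u - s) = u" by (simp add: linear_diff[OF lin] algebra_simps)
  then show ?thesis by blast
qed

lemma finite_rank_psd_conjugate:
  fixes S :: "'a::real_inner \<Rightarrow>\<^sub>L 'a"
  assumes H: "finite_rank_psd H" and S: "psd_operator S"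
  shows "finite_rank_psd (\<lambda>x. S (H (S x)))"
proof -
  obtain A where A: "finite A" "range H \<subseteq> span A" using H by (auto simp: finite_rank_psd_def)
  have "range (\<lambda>x. S (H (S x))) \<subseteq> S ` span A" using A by auto
  also have "\<dots> = span (S ` A)"
    by (rule linear_span_image[symmetric]) (rule bounded_linear.linear[OF blinfun.bounded_linear_right])
  finally have range: "range (\<lambda>x. S (H (S x))) \<subseteq> span (S ` A)" .
  have bl: "bounded_linear (\<lambda>x. S (H (S x)))"
    using H unfolding finite_rank_psd_def
    by (intro bounded_linear_compose[OF blinfun.bounded_linear_right
          bounded_linear_compose[OF _ blinfun.bounded_linear_right]]) simp
  have S_sym: "S x \<bullet> y = x \<bullet> S y" for x y using S by (simp add: psd_operator_def)
  have H_sym: "H x \<bullet> y = x \<bullet> H y" and H_psd: "0 \<le> H x \<bullet> x" for x y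
    using H by (auto simp: finite_rank_psd_def)
  show ?thesis
  proof (rule finite_rank_psdI[OF bl _ _ _ range])
    show "S (H (S x)) \<bullet> y = x \<bullet> S (H (S y))" for x y by (simp add: S_sym H_sym)
    show "0 \<le> S (H (S x)) \<bullet> x" for x using H_psd[of "S x"] S_sym[of "H (S x)" x] by simp
  qed (use A in simp)
qed

section \<open>Fredholm determinants and rank-one perturbations\<close>

text \<open>
  Sylvester's identity: both sides are the determinant of the block matrix with rows \<open>(1, A)\<close> and
  \<open>(-B, 1)\<close>, which factors into block triangular matrices in two ways.
\<close>
lemma det_one_plus_mult_commute:
  fixes A B :: "'a::idom mat"
  assumes A: "A \<in> carrier_mat n m" and B: "B \<in> carrier_mat m n"
  shows "Determinant.det (1\<^sub>m n + A * B) = Determinant.det (1\<^sub>m m + B * A)"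
proof -
  let ?M = "four_block_mat (1\<^sub>m n) A (- B) (1\<^sub>m m)"
  let ?U = "four_block_mat (1\<^sub>m n + A * B) A (0\<^sub>m m n) (1\<^sub>m m)"
  let ?U' = "four_block_mat (1\<^sub>m n) A (0\<^sub>m m n) (1\<^sub>m m + B * A)"
  let ?L = "four_block_mat (1\<^sub>m n) (0\<^sub>m n m) (- B) (1\<^sub>m m)"
  have AB: "A * B \<in> carrier_mat n n" and BA: "B * A \<in> carrier_mat m m" using A B by auto
  have "?U * ?L = four_block_mat ((1\<^sub>m n + A * B) * 1\<^sub>m n + A * (- B)) ((1\<^sub>m n + A * B) * 0\<^sub>m n m + A * 1\<^sub>m m)
      (0\<^sub>m m n * 1\<^sub>m n + 1\<^sub>m m * (- B)) (0\<^sub>m m n * 0\<^sub>m n m + 1\<^sub>m m * 1\<^sub>m m)"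
    using A B by (intro mult_four_block_mat) auto
  also have "\<dots> = ?M"
  proof -
    have "A * (- B) = - (A * B)" using A B by simp
    then have "(1\<^sub>m n + A * B) * 1\<^sub>m n + A * (- B) = 1\<^sub>m n"
      using A B by (intro eq_matI) auto
    moreover have "(1\<^sub>m n + A * B) * 0\<^sub>m n m + A * 1\<^sub>m m = A"
      using A right_mult_zero_mat[of "1\<^sub>m n + A * B" n n m] AB by simp
    moreover have "0\<^sub>m m n * 1\<^sub>m n + 1\<^sub>m m * (- B) = - B" using B by simp
    moreover have "0\<^sub>m m n * 0\<^sub>m n m + 1\<^sub>m m * 1\<^sub>m m = (1\<^sub>m m :: 'a mat)"
      using left_add_zero_mat[of "1\<^sub>m m :: 'a mat" m m] by simp
    ultimately show ?thesis by simp
  qed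
  finally have M1: "?M = ?U * ?L" by simp
  have "?L * ?U' = four_block_mat (1\<^sub>m n * 1\<^sub>m n + 0\<^sub>m n m * 0\<^sub>m m n) (1\<^sub>m n * A + 0\<^sub>m n m * (1\<^sub>m m + B * A))
      (- B * 1\<^sub>m n + 1\<^sub>m m * 0\<^sub>m m n) (- B * A + 1\<^sub>m m * (1\<^sub>m m + B * A))"
    using A B by (intro mult_four_block_mat) auto
  also have "\<dots> = ?M"
  proof -
    have "- B * A = - (B * A)" using A B by simp
    then have "- B * A + 1\<^sub>m m * (1\<^sub>m m + B * A) = 1\<^sub>m m"
      using A B by (intro eq_matI) auto
    moreover have "1\<^sub>m n * A + 0\<^sub>m n m * (1\<^sub>m m + B * A) = A"
      using A left_mult_zero_mat[of "1\<^sub>m m + B * A" m m n] BA by simp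
    moreover have "- B * 1\<^sub>m n + 1\<^sub>m m * 0\<^sub>m m n = - B" using B by simp
    moreover have "1\<^sub>m n * 1\<^sub>m n + 0\<^sub>m n m * 0\<^sub>m m n = (1\<^sub>m n :: 'a mat)"
      using right_add_zero_mat[of "1\<^sub>m n :: 'a mat" n n] by simp
    ultimately show ?thesis by simp
  qed
  finally have M2: "?M = ?L * ?U'" by simp
  have U: "Determinant.det ?U = Determinant.det (1\<^sub>m n + A * B)"
    using A B by (subst det_four_block_mat_lower_left_zero[of _ n _ m]) auto
  have U': "Determinant.det ?U' = Determinant.det (1\<^sub>m m + B * A)"
    using A B by (subst det_four_block_mat_lower_left_zero[of _ n _ m]) auto
  have L: "Determinant.det ?L = 1"
    using B by (subst det_four_block_mat_upper_right_zero[of _ n _ m]) auto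
  have "Determinant.det ?M = Determinant.det ?U * Determinant.det ?L"
    unfolding M1 using A B by (intro Determinant.det_mult[of _ "n + m"]) auto
  moreover have "Determinant.det ?M = Determinant.det ?L * Determinant.det ?U'"
    unfolding M2 using A B by (intro Determinant.det_mult[of _ "n + m"]) auto
  ultimately show ?thesis using U U' L by simp
qed

text \<open>
  The eigenspace for \<open>\<mu> \<noteq> 0\<close> is spanned by the \<open>e\<close> with \<open>l e = \<mu>\<close>, so grouping the product over \<open>E\<close> by
  eigenvalue gives the product in the definition. The spectrum is finite, so the limit is the value
  at the whole set.
\<close>
lemma fredholm_det_eq_prod:
  fixes T :: "'a::real_inner \<Rightarrow> 'a"
  assumes fin: "finite E" and on: "orthonormal E"
    and pos: "\<And>e. e \<in> E \<Longrightarrow> 0 < l e" and eigen: "\<And>e. e \<in> E \<Longrightarrow> T e = l e *\<^sub>R e"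
    and T: "\<And>x. T x = (\<Sum>e\<in>E. (l e * (x \<bullet> e)) *\<^sub>R e)"
  shows "fredholm_det T = (\<Prod>e\<in>E. 1 + l e)"
proof -
  let ?E = "\<lambda>\<mu>. {e\<in>E. l e = \<mu>}"
  have lin: "linear T" unfolding T
    by (rule linearI) (simp_all add: inner_add_left algebra_simps sum.distrib scaleR_sum_right)
  have espace: "eigenspace T \<mu> = span (?E \<mu>)" if "\<mu> \<noteq> 0" for \<mu>
  proof
    show "eigenspace T \<mu> \<subseteq> span (?E \<mu>)"
    proof
      fix x assume "x \<in> eigenspace T \<mu>"
      then have x: "T x = \<mu> *\<^sub>R x" by (simp add: eigenspace_def)
      have "(l e * (x \<bullet> e)) *\<^sub>R e \<in> span (?E \<mu>)" if "e \<in> E" for e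
      proof (cases "l e = \<mu>")
        case False
        have "T x \<bullet> e = (\<Sum>f\<in>E. if f = e then l f * (x \<bullet> f) else 0)"
          unfolding T inner_sum_left using on that
          by (intro sum.cong) (auto simp: orthonormal_def)
        then have "\<mu> * (x \<bullet> e) = l e * (x \<bullet> e)" using fin that by (simp add: x)
        then have "x \<bullet> e = 0" using False by simp
        then show ?thesis by (simp add: span_zero)
      qed (use that in \<open>auto intro: span_scale span_base\<close>)
      then have "T x \<in> span (?E \<mu>)" unfolding T by (rule span_sum)
      then have "(1 / \<mu>) *\<^sub>R T x \<in> span (?E \<mu>)" by (rule span_scale)
      then show "x \<in> span (?E \<mu>)" using that by (simp add: x)
    qed
    have "subspace (eigenspace T \<mu>)"
      using lin by (auto simp: eigenspace_def subspace_def linear_add linear_scale linear_0 algebra_simps)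
    then show "span (?E \<mu>) \<subseteq> eigenspace T \<mu>"
      using eigen by (intro span_minimal) (auto simp: eigenspace_def)
  qed
  have indep: "independent (?E \<mu>)" for \<mu>
    using orthonormal_independent[OF on] by (rule independent_mono) auto
  have dim: "dim (eigenspace T \<mu>) = card (?E \<mu>)" if "\<mu> \<noteq> 0" for \<mu>
    using espace[OF that] indep[of \<mu>] by (simp add: dim_eq_card_independent)
  have spectrum: "{\<mu>. \<mu> \<noteq> 0 \<and> eigenspace T \<mu> \<noteq> {0}} = l ` E"
  proof (intro equalityI subsetI)
    fix \<mu> assume "\<mu> \<in> {\<mu>. \<mu> \<noteq> 0 \<and> eigenspace T \<mu> \<noteq> {0}}"
    then have "span (?E \<mu>) \<noteq> {0}" using espace[of \<mu>] by auto
    then have "?E \<mu> \<noteq> {}" by (metis span_empty)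
    then show "\<mu> \<in> l ` E" by auto
  next
    fix \<mu> assume "\<mu> \<in> l ` E"
    then obtain e where e: "e \<in> E" "\<mu> = l e" by auto
    have "e \<noteq> 0" using on e by (metis inner_zero_left orthonormal_def zero_neq_one)
    moreover have "e \<in> eigenspace T \<mu>" using eigen e by (simp add: eigenspace_def)
    ultimately show "\<mu> \<in> {\<mu>. \<mu> \<noteq> 0 \<and> eigenspace T \<mu> \<noteq> {0}}" using pos e by force
  qed
  have "fredholm_det T = (\<Prod>\<mu>\<in>l ` E. (1 + \<mu>) ^ dim (eigenspace T \<mu>))"
    unfolding fredholm_det_def spectrum finite_subsets_at_top_finite[OF finite_imageI[OF fin]]
    by (rule tendsto_Lim) (auto simp: principal_eq_bot_iff tendsto_principal_singleton)
  also have "\<dots> = (\<Prod>\<mu>\<in>l ` E. \<Prod>e\<in>?E \<mu>. 1 + l e)"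
  proof (intro prod.cong refl)
    fix \<mu> assume "\<mu> \<in> l ` E"
    then have "\<mu> \<noteq> 0" using pos by force
    moreover have "(\<Prod>e\<in>?E \<mu>. 1 + l e) = (\<Prod>e\<in>?E \<mu>. 1 + \<mu>)" by (intro prod.cong) auto
    ultimately show "(1 + \<mu>) ^ dim (eigenspace T \<mu>) = (\<Prod>e\<in>?E \<mu>. 1 + l e)" by (simp add: dim)
  qed
  also have "\<dots> = (\<Prod>e\<in>E. 1 + l e)" by (rule prod.image_gen[symmetric, OF fin])
  finally show ?thesis .
qed

lemma fredholm_det_pos:
  assumes "finite_rank_psd T"
  shows "0 < fredholm_det T"
proof -
  obtain E l where E: "finite E" "orthonormal E" and pos: "\<And>e. e \<in> E \<Longrightarrow> 0 < l e"
    and T: "\<And>e. e \<in> E \<Longrightarrow> T e = l e *\<^sub>R e" "\<And>x. T x = (\<Sum>e\<in>E. (l e * (x \<bullet> e)) *\<^sub>R e)"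
    by (rule finite_rank_psd_spectral[OF assms]) (rule that)
  have "fredholm_det T = (\<Prod>e\<in>E. 1 + l e)" by (rule fredholm_det_eq_prod[OF E pos T])
  also have "\<dots> > 0" using pos by (intro prod_pos) (auto simp: add_pos_pos)
  finally show ?thesis .
qed

lemma sum_nth_distinct:
  assumes "distinct xs"
  shows "(\<Sum>k = 0..<length xs. f (xs ! k)) = (\<Sum>x\<in>set xs. f x)"
  using assms by (simp add: sum.distinct_set_conv_list sum_list_sum_nth)

text \<open>
  The matrix of \<open>T\<close> in the basis \<open>vs\<close> is \<open>C\<^sup>T \<Lambda> C\<close>, where \<open>C\<close> holds the coordinates of the eigenvectors
  and \<open>\<Lambda>\<close> is the diagonal of eigenvalues. Since the eigenvectors lie in the span of \<open>vs\<close>, \<open>C C\<^sup>T = 1\<close>,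
  and Sylvester's identity reduces the determinant to that of \<open>1 + \<Lambda>\<close>. The basis is independent of the
  eigenvectors, which allows two operators to be compared in a common basis.
\<close>
lemma fredholm_det_eq_det:
  fixes T :: "'a::real_inner \<Rightarrow> 'a"
  assumes T: "finite_rank_psd T" and dist: "distinct vs" and on: "orthonormal (set vs)"
    and range: "range T \<subseteq> span (set vs)"
  shows "fredholm_det T = Determinant.det
    (1\<^sub>m (length vs) + Matrix.mat (length vs) (length vs) (\<lambda>(i, j). T (vs ! i) \<bullet> vs ! j))"
proof -
  obtain E l where E: "finite E" "orthonormal E"
    and pos: "\<And>e. e \<in> E \<Longrightarrow> 0 < l e" and eigen: "\<And>e. e \<in> E \<Longrightarrow> T e = l e *\<^sub>R e"
    and Teq: "\<And>x. T x = (\<Sum>e\<in>E. (l e * (x \<bullet> e)) *\<^sub>R e)"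
    by (rule finite_rank_psd_spectral[OF T]) (rule that)
  obtain es where es: "set es = E" "distinct es" using finite_distinct_list[OF E(1)] by blast
  let ?n = "length vs" and ?r = "length es"
  define A where "A = Matrix.mat ?n ?r (\<lambda>(i, k). l (es ! k) * (es ! k \<bullet> vs ! i))"
  define B where "B = Matrix.mat ?r ?n (\<lambda>(k, j). es ! k \<bullet> vs ! j)"
  have A: "A \<in> carrier_mat ?n ?r" and B: "B \<in> carrier_mat ?r ?n" by (simp_all add: A_def B_def)
  have AB: "A * B = Matrix.mat ?n ?n (\<lambda>(i, j). T (vs ! i) \<bullet> vs ! j)"
  proof (rule eq_matI)
    fix i j assume "i < dim_row (Matrix.mat ?n ?n (\<lambda>(i, j). T (vs ! i) \<bullet> vs ! j))"
      "j < dim_col (Matrix.mat ?n ?n (\<lambda>(i, j). T (vs ! i) \<bullet> vs ! j))"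
    then have ij: "i < ?n" "j < ?n" by auto
    have "(A * B) $$ (i, j) = (\<Sum>k = 0..<?r. l (es ! k) * (es ! k \<bullet> vs ! i) * (es ! k \<bullet> vs ! j))"
      using ij by (simp add: A_def B_def scalar_prod_def)
    also have "\<dots> = (\<Sum>e\<in>E. l e * (e \<bullet> vs ! i) * (e \<bullet> vs ! j))"
      using sum_nth_distinct[OF es(2), of "\<lambda>e. l e * (e \<bullet> vs ! i) * (e \<bullet> vs ! j)"] es(1) by simp
    also have "\<dots> = T (vs ! i) \<bullet> vs ! j"
      by (simp add: Teq inner_sum_left inner_commute[of _ "vs ! i"])
    finally show "(A * B) $$ (i, j) = Matrix.mat ?n ?n (\<lambda>(i, j). T (vs ! i) \<bullet> vs ! j) $$ (i, j)"
      using ij by simp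
  qed (simp_all add: A_def B_def)
  define D where "D = Matrix.mat ?r ?r (\<lambda>(k, k'). if k = k' then 1 + l (es ! k) else 0)"
  have E_span: "e \<in> span (set vs)" if "e \<in> E" for e
  proof -
    have "e = (1 / l e) *\<^sub>R T e" using pos[OF that] eigen[OF that] by simp
    also have "\<dots> \<in> span (set vs)" using range by (intro span_scale) auto
    finally show ?thesis .
  qed
  have BA: "1\<^sub>m ?r + B * A = D"
  proof (rule eq_matI)
    fix k k' assume "k < dim_row D" "k' < dim_col D"
    then have k: "k < ?r" "k' < ?r" by (auto simp: D_def)
    then have kE: "es ! k \<in> E" "es ! k' \<in> E" using es(1) by auto
    have "(B * A) $$ (k, k') = (\<Sum>i = 0..<?n. (es ! k \<bullet> vs ! i) * (l (es ! k') * (es ! k' \<bullet> vs ! i)))"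
      using k by (simp add: A_def B_def scalar_prod_def)
    also have "\<dots> = (\<Sum>v\<in>set vs. (es ! k \<bullet> v) * (l (es ! k') * (es ! k' \<bullet> v)))"
      using sum_nth_distinct[OF dist, of "\<lambda>v. (es ! k \<bullet> v) * (l (es ! k') * (es ! k' \<bullet> v))"] by simp
    also have "\<dots> = l (es ! k') * (es ! k \<bullet> es ! k')"
      using orthonormal_Parseval[OF _ on E_span[OF kE(1)], of "es ! k'"]
      by (simp add: sum_distrib_left mult_ac flip: sum_distrib_left)
    also have "\<dots> = (if k = k' then l (es ! k) else 0)"
      using E(2) kE k es(2) by (auto simp: orthonormal_def nth_eq_iff_index_eq)
    finally show "(1\<^sub>m ?r + B * A) $$ (k, k') = D $$ (k, k')"
      using k A B by (simp add: D_def)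
  qed (use A B in \<open>simp_all add: D_def\<close>)
  have "Determinant.det D = prod_list (diag_mat D)"
    by (rule det_upper_triangular[of _ ?r]) (auto simp: D_def)
  also have "diag_mat D = map (\<lambda>e. 1 + l e) es"
    by (auto simp: D_def diag_mat_def intro!: nth_equalityI)
  also have "prod_list \<dots> = (\<Prod>e\<in>E. 1 + l e)"
    using prod.distinct_set_conv_list[OF es(2), of "\<lambda>e. 1 + l e"] es(1) by simp
  also have "\<dots> = fredholm_det T" using fredholm_det_eq_prod[OF E pos eigen Teq] by simp
  finally show ?thesis using det_one_plus_mult_commute[OF A B] by (simp add: AB BA)
qed

lemma finite_rank_psd_add_rank_one:
  assumes T: "finite_rank_psd T"
  shows "finite_rank_psd (\<lambda>x. T x + (x \<bullet> u) *\<^sub>R u)"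
proof -
  obtain A where A: "finite A" "range T \<subseteq> span A" using T by (auto simp: finite_rank_psd_def)
  have "span A \<subseteq> span (insert u A)" by (rule span_mono) auto
  with A have "range (\<lambda>x. T x + (x \<bullet> u) *\<^sub>R u) \<subseteq> span (insert u A)"
    by (auto intro!: span_add span_scale intro: span_base)
  moreover have "bounded_linear (\<lambda>x. T x + (x \<bullet> u) *\<^sub>R u)"
    using T by (auto simp: finite_rank_psd_def intro!: bounded_linear_intros)
  moreover have "finite (insert u A)" using A by simp
  moreover have "0 \<le> T x \<bullet> x + (x \<bullet> u) * (u \<bullet> x)" for x
    using T by (auto simp: finite_rank_psd_def inner_commute[of u] intro!: add_nonneg_nonneg)
  ultimately show ?thesis
    using T unfolding finite_rank_psd_def
    by (auto simp: inner_add_left inner_add_right inner_commute[of u] intro!: exI[of _ "insert u A"])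
qed

text \<open>
  In an orthonormal basis of a finite-dimensional space that contains \<open>u\<close> and the range of \<open>T\<close>, let \<open>M\<close>
  be the matrix of \<open>1 + T\<close>. The perturbed matrix is \<open>M + u u\<^sup>T = M (1 + z u\<^sup>T)\<close>, because \<open>M z = u\<close>, and
  Sylvester's identity turns the determinant of the second factor into the number \<open>1 + \<langle>z, u\<rangle>\<close>.
\<close>
theorem fredholm_det_add_rank_one:
  fixes T :: "'a::real_inner \<Rightarrow> 'a"
  assumes T: "finite_rank_psd T" and z: "z + T z = u"
  shows "fredholm_det (\<lambda>x. T x + (x \<bullet> u) *\<^sub>R u) = fredholm_det T * (1 + z \<bullet> u)"
proof -
  have sym: "\<And>x y. T x \<bullet> y = x \<bullet> T y" using T by (auto simp: finite_rank_psd_def)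
  obtain A where A: "finite A" "range T \<subseteq> span A" using T by (auto simp: finite_rank_psd_def)
  obtain V where V: "finite V" "orthonormal V" "span V = span (insert u A)"
    using orthonormal_basis_exists[of "insert u A"] A by auto
  obtain vs where vs: "set vs = V" "distinct vs" using finite_distinct_list[OF V(1)] by blast
  have "span A \<subseteq> span V" unfolding V(3) by (rule span_mono) auto
  then have range: "range T \<subseteq> span V" using A by auto
  have u: "u \<in> span V" unfolding V(3) by (simp add: span_base)
  have "z = u - T z" using z by (simp add: algebra_simps)
  also have "\<dots> \<in> span V" using u range by (intro span_diff) auto
  finally have zV: "z \<in> span V" .
  let ?n = "length vs"
  define M where "M = 1\<^sub>m ?n + Matrix.mat ?n ?n (\<lambda>(i, j). T (vs ! i) \<bullet> vs ! j)"
  define M' where "M' = 1\<^sub>m ?n + Matrix.mat ?n ?n (\<lambda>(i, j). (T (vs ! i) + (vs ! i \<bullet> u) *\<^sub>R u) \<bullet> vs ! j)"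
  define Z where "Z = Matrix.mat ?n 1 (\<lambda>(i, k). z \<bullet> vs ! i)"
  define R where "R = Matrix.mat 1 ?n (\<lambda>(k, j). u \<bullet> vs ! j)"
  have M: "M \<in> carrier_mat ?n ?n" and Z: "Z \<in> carrier_mat ?n 1" and R: "R \<in> carrier_mat 1 ?n"
    by (simp_all add: M_def Z_def R_def)
  have MZ: "(M * Z) $$ (i, 0) = vs ! i \<bullet> u" if i: "i < ?n" for i
  proof -
    have "(M * Z) $$ (i, 0) = (\<Sum>j = 0..<?n. ((if i = j then 1 else 0) + T (vs ! i) \<bullet> vs ! j) * (z \<bullet> vs ! j))"
      using i by (auto simp: M_def Z_def scalar_prod_def intro!: sum.cong)
    also have "\<dots> = (\<Sum>j = 0..<?n. (if j = i then z \<bullet> vs ! j else 0) + (z \<bullet> vs ! j) * (T (vs ! i) \<bullet> vs ! j))"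
      by (intro sum.cong) (auto simp: algebra_simps)
    also have "\<dots> = z \<bullet> vs ! i + (\<Sum>j = 0..<?n. (z \<bullet> vs ! j) * (T (vs ! i) \<bullet> vs ! j))"
      using i by (simp add: sum.distrib)
    also have "(\<Sum>j = 0..<?n. (z \<bullet> vs ! j) * (T (vs ! i) \<bullet> vs ! j)) = z \<bullet> T (vs ! i)"
      using sum_nth_distinct[OF vs(2), of "\<lambda>v. (z \<bullet> v) * (T (vs ! i) \<bullet> v)"]
        orthonormal_Parseval[OF V(1,2) zV, of "T (vs ! i)"] vs(1) by simp
    also have "z \<bullet> vs ! i + z \<bullet> T (vs ! i) = (z + T z) \<bullet> vs ! i"
      by (simp add: inner_add_left sym)
    also have "\<dots> = vs ! i \<bullet> u" by (simp add: z inner_commute)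
    finally show ?thesis .
  qed
  have "M' = M * (1\<^sub>m ?n + Z * R)"
  proof -
    have "M * (1\<^sub>m ?n + Z * R) = M + (M * Z) * R"
      using M Z R by (simp add: mult_add_distrib_mat[of _ ?n ?n _ ?n])
    also have "\<dots> = M'"
    proof (rule eq_matI)
      fix i j assume "i < dim_row M'" "j < dim_col M'"
      then have ij: "i < ?n" "j < ?n" by (auto simp: M'_def)
      have "((M * Z) * R) $$ (i, j) = (M * Z) $$ (i, 0) * R $$ (0, j)"
        using ij M Z R by (simp add: scalar_prod_def sum_distrib_right mult.assoc)
      then show "(M + (M * Z) * R) $$ (i, j) = M' $$ (i, j)"
        using ij M Z R MZ[OF ij(1)] by (simp add: M_def M'_def R_def inner_add_left)
    qed (use M Z R in \<open>auto simp: M'_def\<close>)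
    finally show ?thesis by simp
  qed
  then have "Determinant.det M' = Determinant.det M * Determinant.det (1\<^sub>m ?n + Z * R)"
    using M Z R by (simp add: Determinant.det_mult[of _ ?n])
  also have "Determinant.det (1\<^sub>m ?n + Z * R) = Determinant.det (1\<^sub>m 1 + R * Z)"
    by (rule det_one_plus_mult_commute[OF Z R])
  also have "\<dots> = (1\<^sub>m 1 + R * Z) $$ (0, 0)" using R Z by (intro det_single) auto
  also have "\<dots> = 1 + (\<Sum>j = 0..<?n. (u \<bullet> vs ! j) * (z \<bullet> vs ! j))"
    by (simp add: R_def Z_def scalar_prod_def)
  also have "(\<Sum>j = 0..<?n. (u \<bullet> vs ! j) * (z \<bullet> vs ! j)) = z \<bullet> u"
    using sum_nth_distinct[OF vs(2), of "\<lambda>v. (u \<bullet> v) * (z \<bullet> v)"]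
      orthonormal_Parseval[OF V(1,2) u, of z] vs(1) by (simp add: inner_commute)
  finally have "Determinant.det M' = Determinant.det M * (1 + z \<bullet> u)" .
  moreover have "fredholm_det T = Determinant.det M"
    unfolding M_def using vs V range by (intro fredholm_det_eq_det T) auto
  moreover have "range (\<lambda>x. T x + (x \<bullet> u) *\<^sub>R u) \<subseteq> span (set vs)"
    using range u vs by (auto intro!: span_add span_scale)
  then have "fredholm_det (\<lambda>x. T x + (x \<bullet> u) *\<^sub>R u) = Determinant.det M'"
    unfolding M'_def using vs V by (intro fredholm_det_eq_det finite_rank_psd_add_rank_one T) auto
  ultimately show ?thesis by simp
qed

section \<open>The noise precision and repeated measurements\<close>

definition riesz :: "('a::real_inner \<Rightarrow>\<^sub>L real) \<Rightarrow> 'a" where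
  "riesz f = (THE r. \<forall>x. f x = x \<bullet> r)"

lemma inner_riesz:
  fixes f :: "'a::{real_inner, complete_space} \<Rightarrow>\<^sub>L real"
  shows "x \<bullet> riesz f = f x"
  unfolding riesz_def
  by (rule theI'[OF Riesz_representation[OF blinfun.bounded_linear_right[of f]], rule_format, symmetric])

lemma dim_meas_apply [simp]: "dim_vec (meas_apply Obs u) = length Obs"
  by (simp add: meas_apply_def)

lemma meas_apply_carrier [simp]: "meas_apply Obs u \<in> carrier_vec (length Obs)"
  by (simp add: meas_apply_def)

lemma meas_apply_index [simp]: "i < length Obs \<Longrightarrow> meas_apply Obs u $ i = (Obs ! i) u"
  by (simp add: meas_apply_def)

lemma meas_adjoint_eq:
  fixes Obs :: "'o::{real_inner, complete_space} measurement"
  assumes v: "v \<in> carrier_vec (length Obs)"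
  shows "meas_adjoint Obs v = (\<Sum>i = 0..<length Obs. v $ i *\<^sub>R riesz (Obs ! i))"
  unfolding meas_adjoint_def
proof (rule the_equality)
  have *: "scalar_prod (meas_apply Obs u) v = u \<bullet> (\<Sum>i = 0..<length Obs. v $ i *\<^sub>R riesz (Obs ! i))" for u
    using v by (simp add: scalar_prod_def inner_sum_right inner_riesz mult.commute)
  then show "\<forall>u. scalar_prod (meas_apply Obs u) v = u \<bullet> (\<Sum>i = 0..<length Obs. v $ i *\<^sub>R riesz (Obs ! i))"
    by blast
  fix w assume "\<forall>u. scalar_prod (meas_apply Obs u) v = u \<bullet> w"
  then have "\<forall>u. u \<bullet> w = u \<bullet> (\<Sum>i = 0..<length Obs. v $ i *\<^sub>R riesz (Obs ! i))" by (simp add: *)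
  then show "w = (\<Sum>i = 0..<length Obs. v $ i *\<^sub>R riesz (Obs ! i))" by (simp only: vector_eq_ldot)
qed

lemma inner_meas_adjoint:
  fixes Obs :: "'o::{real_inner, complete_space} measurement"
  assumes v: "v \<in> carrier_vec (length Obs)"
  shows "u \<bullet> meas_adjoint Obs v = scalar_prod (meas_apply Obs u) v"
  using v by (simp add: meas_adjoint_eq scalar_prod_def inner_sum_right inner_riesz mult.commute)

lemma meas_adjoint_unit_vec:
  fixes Obs :: "'o::{real_inner, complete_space} measurement"
  assumes "k < length Obs"
  shows "meas_adjoint Obs (unit_vec (length Obs) k) = riesz (Obs ! k)"
proof -
  have "meas_adjoint Obs (unit_vec (length Obs) k)
      = (\<Sum>i = 0..<length Obs. if i = k then riesz (Obs ! i) else 0)"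
    unfolding meas_adjoint_eq[OF unit_vec_carrier] using assms by (intro sum.cong) auto
  then show ?thesis using assms by simp
qed

lemma meas_adjoint_snoc:
  fixes Obs :: "'o::{real_inner, complete_space} measurement"
  assumes a: "a \<in> carrier_vec (length Obs)"
  shows "meas_adjoint (Obs @ [f]) (Matrix.vec (Suc (length Obs)) (\<lambda>i. if i < length Obs then a $ i else b))
    = meas_adjoint Obs a + b *\<^sub>R riesz f"
  by (auto simp: meas_adjoint_eq[OF a] meas_adjoint_eq nth_append intro!: sum.cong)

context
  fixes \<Gamma> :: "'o::{real_inner, complete_space} \<Rightarrow>\<^sub>L 'o" and \<sigma> :: real
  assumes \<Gamma>: "psd_operator \<Gamma>" and \<sigma>: "0 < \<sigma>\<^sup>2"
begin

lemma noise_cov_carrier: "noise_cov \<Gamma> \<sigma> Obs \<in> carrier_mat (length Obs) (length Obs)"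
  by (simp add: noise_cov_def Let_def)

lemma noise_cov_mult_vec_index:
  assumes v: "v \<in> carrier_vec (length Obs)" and i: "i < length Obs"
  shows "(noise_cov \<Gamma> \<sigma> Obs *\<^sub>v v) $ i = (Obs ! i) (\<Gamma> (meas_adjoint Obs v)) + \<sigma>\<^sup>2 * v $ i"
proof -
  let ?n = "length Obs"
  have "(noise_cov \<Gamma> \<sigma> Obs *\<^sub>v v) $ i
      = (\<Sum>k = 0..<?n. ((Obs ! i) (\<Gamma> (riesz (Obs ! k))) + \<sigma>\<^sup>2 * (if i = k then 1 else 0)) * v $ k)"
    using v i by (auto simp: noise_cov_def Let_def scalar_prod_def meas_adjoint_unit_vec intro!: sum.cong)
  also have "\<dots> = (\<Sum>k = 0..<?n. v $ k * (Obs ! i) (\<Gamma> (riesz (Obs ! k))) + (if k = i then \<sigma>\<^sup>2 * v $ k else 0))"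
    by (intro sum.cong) (auto simp: algebra_simps)
  also have "\<dots> = (Obs ! i) (\<Gamma> (meas_adjoint Obs v)) + \<sigma>\<^sup>2 * v $ i"
    using i by (simp add: sum.distrib meas_adjoint_eq[OF v] blinfun.sum_right blinfun.scaleR_right)
  finally show ?thesis .
qed

text \<open>
  All properties of the noise covariance and its inverse come from this bilinear form, which is
  symmetric and bounded below by \<open>\<sigma>\<^sup>2\<close> times the scalar product.
\<close>
lemma noise_cov_form:
  assumes v: "v \<in> carrier_vec (length Obs)" and v': "v' \<in> carrier_vec (length Obs)"
  shows "scalar_prod (noise_cov \<Gamma> \<sigma> Obs *\<^sub>v v) v'
    = \<Gamma> (meas_adjoint Obs v) \<bullet> meas_adjoint Obs v' + \<sigma>\<^sup>2 * scalar_prod v v'"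
proof -
  have "scalar_prod (noise_cov \<Gamma> \<sigma> Obs *\<^sub>v v) v'
      = (\<Sum>i = 0..<length Obs. ((Obs ! i) (\<Gamma> (meas_adjoint Obs v)) + \<sigma>\<^sup>2 * v $ i) * v' $ i)"
    unfolding scalar_prod_def using v v' by (intro sum.cong) (auto simp: noise_cov_mult_vec_index)
  then show ?thesis
    using v v' by (simp add: inner_meas_adjoint scalar_prod_def distrib_right sum.distrib
        sum_distrib_left mult.assoc)
qed

lemma scalar_prod_self_ge: 
  fixes v :: "real Matrix.vec"
  assumes "i < dim_vec v"
  shows "(v $ i)\<^sup>2 \<le> scalar_prod v v"
  unfolding scalar_prod_def power2_eq_square using assms by (intro member_le_sum) auto

text \<open>By the lower bound on its form the noise covariance has trivial kernel, hence is invertible.\<close>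
lemma noise_prec_inverse:
  shows noise_prec_carrier: "noise_prec \<Gamma> \<sigma> Obs \<in> carrier_mat (length Obs) (length Obs)"
    and noise_cov_noise_prec: "noise_cov \<Gamma> \<sigma> Obs * noise_prec \<Gamma> \<sigma> Obs = 1\<^sub>m (length Obs)"
    and noise_prec_noise_cov: "noise_prec \<Gamma> \<sigma> Obs * noise_cov \<Gamma> \<sigma> Obs = 1\<^sub>m (length Obs)"
proof -
  let ?n = "length Obs" and ?S = "noise_cov \<Gamma> \<sigma> Obs"
  have "v = 0\<^sub>v ?n" if v: "v \<in> carrier_vec ?n" and 0: "?S *\<^sub>v v = 0\<^sub>v ?n" for v
  proof (rule eq_vecI)
    have "\<Gamma> (meas_adjoint Obs v) \<bullet> meas_adjoint Obs v + \<sigma>\<^sup>2 * scalar_prod v v = 0"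
      using noise_cov_form[OF v v] v by (simp add: 0)
    moreover have "0 \<le> \<Gamma> (meas_adjoint Obs v) \<bullet> meas_adjoint Obs v"
      using \<Gamma> by (rule psd_operator_nonneg)
    ultimately have "\<sigma>\<^sup>2 * scalar_prod v v \<le> 0" by linarith
    then have le_0: "scalar_prod v v \<le> 0" using \<sigma> by (simp add: mult_le_0_iff)
    have "(v $ i)\<^sup>2 \<le> 0" if "i < ?n" for i
      using order_trans[OF scalar_prod_self_ge[of i v] le_0] v that by simp
    then show "v $ i = 0\<^sub>v ?n $ i" if "i < dim_vec (0\<^sub>v ?n)" for i using that by simp
  qed (use v in simp)
  then have "Determinant.det ?S \<noteq> 0"
    using det_0_iff_vec_prod_zero_field[OF noise_cov_carrier[of Obs]] by blast
  then have "mat_inverse ?S \<noteq> None"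
    using mat_inverse(1)[OF noise_cov_carrier[of Obs], where b = "()"]
      det_non_zero_imp_unit[OF noise_cov_carrier[of Obs], where b = "()"]
    by blast
  then have "mat_inverse ?S = Some (noise_prec \<Gamma> \<sigma> Obs)" by (auto simp: noise_prec_def)
  from mat_inverse(2)[OF noise_cov_carrier this]
  show "noise_prec \<Gamma> \<sigma> Obs \<in> carrier_mat ?n ?n" "?S * noise_prec \<Gamma> \<sigma> Obs = 1\<^sub>m ?n"
    "noise_prec \<Gamma> \<sigma> Obs * ?S = 1\<^sub>m ?n" by auto
qed

lemma noise_prec_mult_carrier:
  assumes "y \<in> carrier_vec (length Obs)"
  shows "noise_prec \<Gamma> \<sigma> Obs *\<^sub>v y \<in> carrier_vec (length Obs)"
  using mult_mat_vec_carrier[OF noise_prec_carrier assms] .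

lemma noise_cov_mult_noise_prec:
  assumes "y \<in> carrier_vec (length Obs)"
  shows "noise_cov \<Gamma> \<sigma> Obs *\<^sub>v (noise_prec \<Gamma> \<sigma> Obs *\<^sub>v y) = y"
  using assoc_mult_mat_vec[OF noise_cov_carrier noise_prec_carrier assms] assms
  by (simp add: noise_cov_noise_prec)

lemma noise_prec_mult_eqI:
  assumes "v \<in> carrier_vec (length Obs)" "noise_cov \<Gamma> \<sigma> Obs *\<^sub>v v = y"
  shows "noise_prec \<Gamma> \<sigma> Obs *\<^sub>v y = v"
  using assoc_mult_mat_vec[OF noise_prec_carrier noise_cov_carrier assms(1)] assms
  by (simp add: noise_prec_noise_cov)

lemma noise_prec_form:
  assumes y: "y \<in> carrier_vec (length Obs)" and y': "y' \<in> carrier_vec (length Obs)"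
  shows "scalar_prod y (noise_prec \<Gamma> \<sigma> Obs *\<^sub>v y')
    = \<Gamma> (meas_adjoint Obs (noise_prec \<Gamma> \<sigma> Obs *\<^sub>v y)) \<bullet> meas_adjoint Obs (noise_prec \<Gamma> \<sigma> Obs *\<^sub>v y')
      + \<sigma>\<^sup>2 * scalar_prod (noise_prec \<Gamma> \<sigma> Obs *\<^sub>v y) (noise_prec \<Gamma> \<sigma> Obs *\<^sub>v y')"
  using noise_cov_form[OF noise_prec_mult_carrier[OF y] noise_prec_mult_carrier[OF y']]
  by (simp add: noise_cov_mult_noise_prec[OF y])

lemma noise_prec_sym:
  assumes y: "y \<in> carrier_vec (length Obs)" and y': "y' \<in> carrier_vec (length Obs)"
  shows "scalar_prod y (noise_prec \<Gamma> \<sigma> Obs *\<^sub>v y') = scalar_prod y' (noise_prec \<Gamma> \<sigma> Obs *\<^sub>v y)"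
proof -
  have "\<Gamma> a \<bullet> b = \<Gamma> b \<bullet> a" for a b
    using psd_operator_sym[OF \<Gamma>, of a b] by (simp add: inner_commute)
  then show ?thesis
    unfolding noise_prec_form[OF y y'] noise_prec_form[OF y' y]
    using comm_scalar_prod[OF noise_prec_mult_carrier[OF y] noise_prec_mult_carrier[OF y']] by simp
qed

lemma noise_prec_nonneg:
  assumes y: "y \<in> carrier_vec (length Obs)"
  shows "0 \<le> scalar_prod y (noise_prec \<Gamma> \<sigma> Obs *\<^sub>v y)"
proof -
  have "0 \<le> scalar_prod v v" for v :: "real Matrix.vec"
    unfolding scalar_prod_def by (intro sum_nonneg) auto
  then show ?thesis
    unfolding noise_prec_form[OF y y] by (intro add_nonneg_nonneg mult_nonneg_nonneg psd_operator_nonneg[OF \<Gamma>]) auto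
qed

text \<open>
  Since \<open>\<Sigma> \<ge> \<sigma>\<^sup>2 I\<close>, the vector \<open>q = \<Sigma>\<^sup>-\<^sup>1 e\<^sub>j\<close> satisfies \<open>q\<^sub>j = \<langle>\<Sigma> q, q\<rangle> \<ge> \<sigma>\<^sup>2 q\<^sub>j\<^sup>2\<close>. This keeps the
  denominator \<open>2 - \<sigma>\<^sup>2 q\<^sub>j\<close> positive.
\<close>
lemma noise_prec_diag_le:
  assumes j: "j < length Obs"
  shows "\<sigma>\<^sup>2 * (noise_prec \<Gamma> \<sigma> Obs *\<^sub>v unit_vec (length Obs) j) $ j \<le> 1"
proof -
  let ?e = "unit_vec (length Obs) j :: real Matrix.vec"
  define q where "q = noise_prec \<Gamma> \<sigma> Obs *\<^sub>v ?e"
  have q: "q \<in> carrier_vec (length Obs)" unfolding q_def by (rule noise_prec_mult_carrier) simp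
  have "\<sigma>\<^sup>2 * (q $ j)\<^sup>2 \<le> \<sigma>\<^sup>2 * scalar_prod q q"
    using scalar_prod_self_ge[of j q] q j by (intro mult_left_mono) auto
  also have "\<dots> \<le> scalar_prod ?e q"
    using noise_prec_form[of ?e Obs ?e] psd_operator_nonneg[OF \<Gamma>, of "meas_adjoint Obs q"]
    by (simp add: q_def[symmetric])
  also have "\<dots> = q $ j" using q j by simp
  finally have "(\<sigma>\<^sup>2 * q $ j) * q $ j \<le> 1 * q $ j" by (simp add: power2_eq_square mult.assoc)
  then have "\<sigma>\<^sup>2 * q $ j \<le> 1"
  proof (cases "0 < q $ j")
    case False
    then have "\<sigma>\<^sup>2 * q $ j \<le> 0" using \<sigma> by (simp add: mult_le_0_iff)
    then show ?thesis by simp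
  qed simp
  then show ?thesis by (simp add: q_def)
qed

lemma inner_misfit_hessian:
  fixes F :: "'p::{real_inner, complete_space} \<Rightarrow>\<^sub>L 'o"
  shows "y \<bullet> misfit_hessian F \<Gamma> \<sigma> Obs x
    = scalar_prod (meas_apply Obs (F y)) (noise_prec \<Gamma> \<sigma> Obs *\<^sub>v meas_apply Obs (F x))"
  by (simp add: misfit_hessian_def inner_meas_adjoint noise_prec_mult_carrier flip: inner_adjoint)

lemma finite_rank_psd_misfit_hessian:
  fixes F :: "'p::{real_inner, complete_space} \<Rightarrow>\<^sub>L 'o"
  shows "finite_rank_psd (misfit_hessian F \<Gamma> \<sigma> Obs)"
proof -
  let ?n = "length Obs" and ?P = "noise_prec \<Gamma> \<sigma> Obs"
  let ?A = "\<lambda>i. adjoint F (riesz (Obs ! i))"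
  interpret adj: bounded_linear "adjoint F" by (rule bounded_linear_adjoint)
  have H: "misfit_hessian F \<Gamma> \<sigma> Obs
      = (\<lambda>x. \<Sum>i = 0..<?n. (\<Sum>k = 0..<?n. ?P $$ (i, k) * (Obs ! k) (F x)) *\<^sub>R ?A i)"
  proof
    fix x
    show "misfit_hessian F \<Gamma> \<sigma> Obs x
        = (\<Sum>i = 0..<?n. (\<Sum>k = 0..<?n. ?P $$ (i, k) * (Obs ! k) (F x)) *\<^sub>R ?A i)"
      using noise_prec_mult_carrier[of "meas_apply Obs (F x)" Obs] noise_prec_carrier[of Obs]
      by (auto simp: misfit_hessian_def meas_adjoint_eq adj.sum adj.scaleR scalar_prod_def
          intro!: sum.cong)
  qed
  have "bounded_linear (\<lambda>x. (Obs ! k) (F x))" for k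
    by (rule bounded_linear_compose[OF blinfun.bounded_linear_right blinfun.bounded_linear_right])
  then have bl: "bounded_linear (misfit_hessian F \<Gamma> \<sigma> Obs)"
    unfolding H
    by (intro bounded_linear_sum bounded_linear_scaleR_const bounded_linear_const_mult)
  have range: "range (misfit_hessian F \<Gamma> \<sigma> Obs) \<subseteq> span (?A ` {0..<?n})"
    unfolding H by (auto intro!: span_sum span_scale intro: span_base)
  show ?thesis
  proof (rule finite_rank_psdI[OF bl _ _ _ range])
    show "misfit_hessian F \<Gamma> \<sigma> Obs x \<bullet> y = x \<bullet> misfit_hessian F \<Gamma> \<sigma> Obs y" for x y
      unfolding inner_commute[of _ y] inner_misfit_hessian by (rule noise_prec_sym) simp_all
    show "0 \<le> misfit_hessian F \<Gamma> \<sigma> Obs x \<bullet> x" for x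
      unfolding inner_commute[of _ x] inner_misfit_hessian by (rule noise_prec_nonneg) simp
  qed simp
qed

text \<open>
  Let \<open>p\<close> be the solution of the original system \<open>\<Sigma> p = Obs F x\<close>. Splitting a multiple \<open>b\<close> of \<open>e\<^sub>j\<close> off
  \<open>p\<close> and assigning it to the copy of the measurement does not change \<open>Obs\<^sup>* p\<close>, but it lowers the noise
  term in row \<open>j\<close>; the correction \<open>b \<sigma>\<^sup>2 q\<close> restores that row. So \<open>(p - b (e\<^sub>j - \<sigma>\<^sup>2 q), b)\<close> solves the
  first rows of the enlarged system for every \<open>b\<close>, and the last row determines \<open>b\<close>.
\<close>
lemma misfit_hessian_repeat:
  fixes F :: "'p::{real_inner, complete_space} \<Rightarrow>\<^sub>L 'o"
  assumes j: "j < length Obs"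
  defines "q \<equiv> noise_prec \<Gamma> \<sigma> Obs *\<^sub>v unit_vec (length Obs) j"
  defines "w \<equiv> meas_adjoint Obs q"
  shows "misfit_hessian F \<Gamma> \<sigma> (Obs @ [Obs ! j]) x
    = misfit_hessian F \<Gamma> \<sigma> Obs x + (\<sigma>\<^sup>2 / (2 - \<sigma>\<^sup>2 * q $ j) * (x \<bullet> adjoint F w)) *\<^sub>R adjoint F w"
proof -
  let ?n = "length Obs" and ?Obs' = "Obs @ [Obs ! j]"
  let ?e = "unit_vec ?n j :: real Matrix.vec"
  have q: "q \<in> carrier_vec ?n" unfolding q_def by (rule noise_prec_mult_carrier) simp
  have nz: "2 - \<sigma>\<^sup>2 * q $ j \<noteq> 0" using noise_prec_diag_le[OF j] by (simp add: q_def)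
  define g where "g = F x"
  define p where "p = noise_prec \<Gamma> \<sigma> Obs *\<^sub>v meas_apply Obs g"
  have p: "p \<in> carrier_vec ?n" unfolding p_def by (rule noise_prec_mult_carrier) simp
  have p_eq: "(Obs ! i) (\<Gamma> (meas_adjoint Obs p)) + \<sigma>\<^sup>2 * p $ i = (Obs ! i) g" if "i < ?n" for i
    using noise_cov_mult_vec_index[OF p that] noise_cov_mult_noise_prec[of "meas_apply Obs g" Obs] that
    by (simp add: p_def)
  have q_eq: "(Obs ! i) (\<Gamma> w) + \<sigma>\<^sup>2 * q $ i = (if i = j then 1 else 0)" if "i < ?n" for i
    using noise_cov_mult_vec_index[OF q that] noise_cov_mult_noise_prec[of ?e Obs] that j
    by (simp add: q_def w_def)
  \<comment> \<open>symmetry of the noise precision turns the coefficient into a functional of \<open>x\<close>\<close>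
  have pj: "p $ j = x \<bullet> adjoint F w"
  proof -
    have "p $ j = scalar_prod ?e p" using p j by simp
    also have "\<dots> = scalar_prod (meas_apply Obs g) q"
      unfolding p_def q_def by (rule noise_prec_sym) simp_all
    also have "\<dots> = g \<bullet> w" using inner_meas_adjoint[OF q] by (simp add: w_def)
    finally show ?thesis by (simp add: g_def inner_adjoint)
  qed
  define b where "b = p $ j / (2 - \<sigma>\<^sup>2 * q $ j)"
  have b: "b * (2 - \<sigma>\<^sup>2 * q $ j) = p $ j" using nz by (simp add: b_def)
  define a where "a = Matrix.vec ?n (\<lambda>i. p $ i - b * ((if i = j then 1 else 0) - \<sigma>\<^sup>2 * q $ i))"
  have a: "a \<in> carrier_vec ?n" by (simp add: a_def)
  define v where "v = Matrix.vec (Suc ?n) (\<lambda>i. if i < ?n then a $ i else b)"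
  have v: "v \<in> carrier_vec (length ?Obs')" by (simp add: v_def)
  have "meas_adjoint Obs a
      = (\<Sum>i = 0..<?n. p $ i *\<^sub>R riesz (Obs ! i) + (b * \<sigma>\<^sup>2) *\<^sub>R (q $ i *\<^sub>R riesz (Obs ! i))
          - (if i = j then b *\<^sub>R riesz (Obs ! i) else 0))"
    unfolding meas_adjoint_eq[OF a] by (intro sum.cong) (auto simp: a_def algebra_simps)
  also have "\<dots> = meas_adjoint Obs p + (b * \<sigma>\<^sup>2) *\<^sub>R w - b *\<^sub>R riesz (Obs ! j)"
    using j unfolding w_def meas_adjoint_eq[OF p] meas_adjoint_eq[OF q]
    by (simp add: sum.distrib sum_subtractf scaleR_sum_right)
  finally have adj_v: "meas_adjoint ?Obs' v = meas_adjoint Obs p + (b * \<sigma>\<^sup>2) *\<^sub>R w"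
    using meas_adjoint_snoc[OF a, of "Obs ! j" b] by (simp add: v_def)
  have "noise_cov \<Gamma> \<sigma> ?Obs' *\<^sub>v v = meas_apply ?Obs' g"
  proof (rule eq_vecI)
    show "dim_vec (noise_cov \<Gamma> \<sigma> ?Obs' *\<^sub>v v) = dim_vec (meas_apply ?Obs' g)"
      using noise_cov_carrier[of ?Obs'] by simp
    fix i assume "i < dim_vec (meas_apply ?Obs' g)"
    then have i: "i < length ?Obs'" by simp
    have *: "(noise_cov \<Gamma> \<sigma> ?Obs' *\<^sub>v v) $ i
        = (?Obs' ! i) (\<Gamma> (meas_adjoint Obs p)) + b * \<sigma>\<^sup>2 * (?Obs' ! i) (\<Gamma> w) + \<sigma>\<^sup>2 * v $ i"
      unfolding noise_cov_mult_vec_index[OF v i] adj_v by (simp add: blinfun.bilinear_simps)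
    show "(noise_cov \<Gamma> \<sigma> ?Obs' *\<^sub>v v) $ i = meas_apply ?Obs' g $ i"
    proof (cases "i < ?n")
      case True
      let ?d = "if i = j then 1 else 0 :: real"
      have "(Obs ! i) (\<Gamma> w) = ?d - \<sigma>\<^sup>2 * q $ i" using q_eq[OF True] by linarith
      then have "(noise_cov \<Gamma> \<sigma> ?Obs' *\<^sub>v v) $ i = (Obs ! i) (\<Gamma> (meas_adjoint Obs p))
          + b * \<sigma>\<^sup>2 * (?d - \<sigma>\<^sup>2 * q $ i) + \<sigma>\<^sup>2 * (p $ i - b * (?d - \<sigma>\<^sup>2 * q $ i))"
        unfolding * using True by (simp add: nth_append v_def a_def)
      also have "\<dots> = (Obs ! i) (\<Gamma> (meas_adjoint Obs p)) + \<sigma>\<^sup>2 * p $ i"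
        by (simp only: right_diff_distrib mult_ac)
      also have "\<dots> = (Obs ! i) g" by (rule p_eq[OF True])
      finally show ?thesis using True by (simp add: nth_append)
    next
      case False
      with i have i: "i = ?n" by simp
      have "(Obs ! j) (\<Gamma> w) = 1 - \<sigma>\<^sup>2 * q $ j" using q_eq[OF j] by simp
      then have "b * \<sigma>\<^sup>2 * (Obs ! j) (\<Gamma> w) + \<sigma>\<^sup>2 * b
          = b * \<sigma>\<^sup>2 * (1 - \<sigma>\<^sup>2 * q $ j) + \<sigma>\<^sup>2 * b" by simp
      also have "\<dots> = \<sigma>\<^sup>2 * (b * (2 - \<sigma>\<^sup>2 * q $ j))" by (simp add: algebra_simps)
      finally have "b * \<sigma>\<^sup>2 * (Obs ! j) (\<Gamma> w) + \<sigma>\<^sup>2 * b = \<sigma>\<^sup>2 * (b * (2 - \<sigma>\<^sup>2 * q $ j))" .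
      then show ?thesis
        unfolding * b using p_eq[OF j] by (simp add: i v_def nth_append)
    qed
  qed
  then have "noise_prec \<Gamma> \<sigma> ?Obs' *\<^sub>v meas_apply ?Obs' g = v" by (rule noise_prec_mult_eqI[OF v])
  then have "misfit_hessian F \<Gamma> \<sigma> ?Obs' x = adjoint F (meas_adjoint Obs p + (b * \<sigma>\<^sup>2) *\<^sub>R w)"
    by (simp add: misfit_hessian_def adj_v flip: g_def)
  also have "\<dots> = adjoint F (meas_adjoint Obs p) + (b * \<sigma>\<^sup>2) *\<^sub>R adjoint F w"
    using bounded_linear.linear[OF bounded_linear_adjoint[of F]] by (simp add: linear_add linear_scale)
  also have "b * \<sigma>\<^sup>2 = \<sigma>\<^sup>2 / (2 - \<sigma>\<^sup>2 * q $ j) * (x \<bullet> adjoint F w)" by (simp add: b_def pj)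
  finally show ?thesis by (simp add: misfit_hessian_def p_def g_def)
qed

end

section \<open>Posterior covariance and information gain\<close>

text \<open>
  Substituting \<open>x = \<Gamma>pr y\<close> removes the unbounded inverse of \<open>\<Gamma>pr\<close>: the inverse image of \<open>b\<close> under
  \<open>\<Gamma>pr\<^sup>-\<^sup>1 + H\<close> is found from \<open>y + H (\<Gamma>pr y) = b\<close>. It is unique because \<open>\<langle>d + H \<Gamma>pr d, \<Gamma>pr d\<rangle> = 0\<close>
  forces \<open>d = 0\<close> by definiteness of \<open>\<Gamma>pr\<close>.
\<close>
lemma post_cov_eqI:
  fixes F :: "'p::{real_inner, complete_space} \<Rightarrow>\<^sub>L 'o::{real_inner, complete_space}"
  assumes pd: "positive_definite \<Gamma>pr"
    and \<Gamma>: "psd_operator \<Gamma>" and \<sigma>: "0 < \<sigma>\<^sup>2"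
    and y: "y + misfit_hessian F \<Gamma> \<sigma> Obs (\<Gamma>pr y) = b"
  shows "post_cov F \<Gamma>pr \<Gamma> \<sigma> Obs b = \<Gamma>pr y"
proof -
  let ?H = "misfit_hessian F \<Gamma> \<sigma> Obs"
  have H: "finite_rank_psd ?H" by (rule finite_rank_psd_misfit_hessian[OF \<Gamma> \<sigma>])
  then have linH: "linear ?H" and psdH: "\<And>x. 0 \<le> ?H x \<bullet> x"
    by (auto simp: finite_rank_psd_def bounded_linear.linear)
  have pos: "0 < \<Gamma>pr x \<bullet> x" if "x \<noteq> 0" for x using pd that by (simp add: positive_definite_def)
  have inj: "inj \<Gamma>pr"
  proof (rule injI)
    fix x x' assume "\<Gamma>pr x = \<Gamma>pr x'"
    then have "\<Gamma>pr (x - x') \<bullet> (x - x') = 0" by (simp add: blinfun.diff_right)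
    then show "x = x'" using pos[of "x - x'"] by (cases "x - x' = 0") auto
  qed
  have "inj_on (\<lambda>x. inv_into UNIV \<Gamma>pr x + ?H x) (range \<Gamma>pr)"
  proof (rule inj_onI)
    fix x x' assume "x \<in> range \<Gamma>pr" "x' \<in> range \<Gamma>pr"
      and eq: "inv_into UNIV \<Gamma>pr x + ?H x = inv_into UNIV \<Gamma>pr x' + ?H x'"
    then obtain z z' where z: "x = \<Gamma>pr z" "x' = \<Gamma>pr z'" by blast
    define d where "d = z - z'"
    have "d + ?H (\<Gamma>pr d) = 0"
      using eq by (simp add: z inv_f_f[OF inj] d_def blinfun.diff_right linear_diff[OF linH] algebra_simps)
    then have "(d + ?H (\<Gamma>pr d)) \<bullet> \<Gamma>pr d = 0" by simp
    then have "\<Gamma>pr d \<bullet> d \<le> 0"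
      using psdH[of "\<Gamma>pr d"] by (simp add: inner_add_left inner_commute[of d])
    then have "d = 0" using pos[of d] by (cases "d = 0") auto
    then show "x = x'" by (simp add: z d_def)
  qed
  then show ?thesis
    unfolding post_cov_def by (rule inv_into_f_eq) (simp_all add: inv_f_f[OF inj] y)
qed

text \<open>
  The repetition adds \<open>u \<otimes> u\<close> to \<open>T\<close>, so the gain is half the logarithm of the quotient of two determinants.
  Both are positive, since \<open>T\<close> is positive semidefinite and \<open>\<langle>(I + T)\<^sup>-\<^sup>1 u, u\<rangle> \<ge> 0\<close>.
\<close>
theorem info_gain_repeat:
  fixes F :: "'p::{real_inner, complete_space} \<Rightarrow>\<^sub>L 'o::{real_inner, complete_space}"
  assumes pr: "psd_operator \<Gamma>pr" "positive_definite \<Gamma>pr"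
    and \<Gamma>: "psd_operator \<Gamma>" and \<sigma>: "0 < \<sigma>\<^sup>2" and j: "j < length Obs"
  defines "q \<equiv> noise_prec \<Gamma> \<sigma> Obs *\<^sub>v unit_vec (length Obs) j"
  defines "w \<equiv> meas_adjoint Obs q"
  shows "info_gain F \<Gamma>pr \<Gamma> \<sigma> (Obs @ [Obs ! j]) - info_gain F \<Gamma>pr \<Gamma> \<sigma> Obs
    = 1 / 2 * ln (1 + \<sigma>\<^sup>2 * (F (post_cov F \<Gamma>pr \<Gamma> \<sigma> Obs (adjoint F w)) \<bullet> w) / (2 - \<sigma>\<^sup>2 * q $ j))"
proof -
  let ?H = "misfit_hessian F \<Gamma> \<sigma> Obs"
  define S where "S = psd_sqrt \<Gamma>pr"
  have S: "psd_operator S" and SS: "\<And>x. S (S x) = \<Gamma>pr x"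
    using psd_operator_psd_sqrt[OF pr(1)] psd_sqrt_psd_sqrt[OF pr(1)] by (simp_all add: S_def)
  have S_sym: "S x \<bullet> y = x \<bullet> S y" for x y using S by (simp add: psd_operator_def)
  have H: "finite_rank_psd ?H" by (rule finite_rank_psd_misfit_hessian[OF \<Gamma> \<sigma>])
  define T where "T x = S (?H (S x))" for x
  have T: "finite_rank_psd T" unfolding T_def by (rule finite_rank_psd_conjugate[OF H S])
  define c where "c = \<sigma>\<^sup>2 / (2 - \<sigma>\<^sup>2 * q $ j)"
  have c: "0 < c"
    using noise_prec_diag_le[OF \<Gamma> \<sigma> j] \<sigma> by (simp add: c_def q_def)
  define u where "u = sqrt c *\<^sub>R S (adjoint F w)"
  have T': "S (misfit_hessian F \<Gamma> \<sigma> (Obs @ [Obs ! j]) (S x)) = T x + (x \<bullet> u) *\<^sub>R u" for x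
    using c misfit_hessian_repeat[OF \<Gamma> \<sigma> j, of F "S x"]
    by (simp add: T_def u_def blinfun.bilinear_simps S_sym c_def[symmetric]
        q_def[symmetric] w_def[symmetric])
  obtain z where z: "z + T z = S (adjoint F w)" using finite_rank_psd_resolvent[OF T] by blast
  \<comment> \<open>\<open>S y = z\<close>, so \<open>y\<close> lifts \<open>z = (I + S H S)\<^sup>-\<^sup>1 S F\<^sup>* w\<close> to the equation that defines the posterior covariance\<close>
  define y where "y = adjoint F w - ?H (S z)"
  have Sy: "S y = z" using z by (simp add: y_def T_def blinfun.diff_right algebra_simps)
  have "y + ?H (\<Gamma>pr y) = adjoint F w" by (simp add: SS[symmetric] Sy) (simp add: y_def)
  then have "post_cov F \<Gamma>pr \<Gamma> \<sigma> Obs (adjoint F w) = \<Gamma>pr y"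
    by (rule post_cov_eqI[OF pr(2) \<Gamma> \<sigma>])
  then have post: "post_cov F \<Gamma>pr \<Gamma> \<sigma> Obs (adjoint F w) = S z" by (simp add: Sy flip: SS)
  define t where "t = z \<bullet> S (adjoint F w)"
  have t: "F (post_cov F \<Gamma>pr \<Gamma> \<sigma> Obs (adjoint F w)) \<bullet> w = t"
    by (simp only: post inner_adjoint[of F] S_sym t_def)
  have "0 \<le> t"
  proof -
    have "t = z \<bullet> z + T z \<bullet> z" unfolding t_def z[symmetric] by (simp add: inner_add_right inner_commute)
    moreover have "0 \<le> T z \<bullet> z" using T unfolding finite_rank_psd_def by blast
    ultimately show ?thesis by simp
  qed
  then have pos: "0 < 1 + c * t" using c by (simp add: add_pos_nonneg)
  have "sqrt c *\<^sub>R z + T (sqrt c *\<^sub>R z) = u"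
    using T by (simp add: finite_rank_psd_def bounded_linear.linear linear_scale u_def
        flip: z scaleR_add_right)
  from fredholm_det_add_rank_one[OF T this]
  have "fredholm_det (\<lambda>x. T x + (x \<bullet> u) *\<^sub>R u) = fredholm_det T * (1 + c * t)"
    using c by (simp add: u_def t_def)
  then have "info_gain F \<Gamma>pr \<Gamma> \<sigma> (Obs @ [Obs ! j]) = 1 / 2 * ln (fredholm_det T * (1 + c * t))"
    unfolding info_gain_def S_def[symmetric] T' by simp
  moreover have "info_gain F \<Gamma>pr \<Gamma> \<sigma> Obs = 1 / 2 * ln (fredholm_det T)"
    unfolding info_gain_def S_def[symmetric] T_def[symmetric] by simp
  ultimately show ?thesis
    using pos fredholm_det_pos[OF T] by (simp add: ln_mult t c_def)
qed

theorem corollary4p2: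
  fixes F :: "'p::{real_inner, polish_space} \<Rightarrow>\<^sub>L 'o::{real_inner, polish_space}"
    and \<Gamma>pr :: "'p \<Rightarrow>\<^sub>L 'p"
    and \<Gamma>model :: "'o \<Rightarrow>\<^sub>L 'o"
    and \<sigma> :: real
    and obs :: "nat \<Rightarrow> 'o \<Rightarrow>\<^sub>L real"
    and m j :: nat
  assumes "gaussian_covariance \<Gamma>pr" and "positive_definite \<Gamma>pr"
    and "psd_operator \<Gamma>model"
    and "\<sigma>\<^sup>2 > 0"
    and "m \<ge> 2"
    and "1 \<le> j" and "j \<le> m - 1"
    and "obs m = obs j"
  shows
    "let Obs = map obs [1..<m + 1];
         Obs_hat = map obs [1..<m];
         \<Sigma>_hat_inv = noise_prec \<Gamma>model \<sigma> Obs_hat;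
         e = unit_vec (m - 1) (j - 1);
         w = meas_adjoint Obs_hat (\<Sigma>_hat_inv *\<^sub>v e)
     in info_gain F \<Gamma>pr \<Gamma>model \<sigma> Obs - info_gain F \<Gamma>pr \<Gamma>model \<sigma> Obs_hat =
        1 / 2 * ln (1 + \<sigma>\<^sup>2 * (F (post_cov F \<Gamma>pr \<Gamma>model \<sigma> Obs_hat (adjoint F w)) \<bullet> w)
                        / (2 - \<sigma>\<^sup>2 * scalar_prod e (\<Sigma>_hat_inv *\<^sub>v e)))"
proof -
  let ?Obs = "map obs [1..<m]"
  have len: "length ?Obs = m - 1" and j': "j - 1 < length ?Obs" using assms by auto
  have "[1..<m + 1] = [1..<m] @ [m]" using assms(5) by (simp add: upt_Suc_append)
  moreover have "?Obs ! (j - 1) = obs m" using assms by simp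
  ultimately have Obs: "map obs [1..<m + 1] = ?Obs @ [?Obs ! (j - 1)]" by simp
  have psd: "psd_operator \<Gamma>pr" using assms(1) by (simp add: gaussian_covariance_def)
  have "noise_prec \<Gamma>model \<sigma> ?Obs *\<^sub>v unit_vec (m - 1) (j - 1) \<in> carrier_vec (m - 1)"
    using noise_prec_mult_carrier[OF assms(3,4), of "unit_vec (m - 1) (j - 1)" ?Obs] len by simp
  then have "scalar_prod (unit_vec (m - 1) (j - 1)) (noise_prec \<Gamma>model \<sigma> ?Obs *\<^sub>v unit_vec (m - 1) (j - 1))
      = (noise_prec \<Gamma>model \<sigma> ?Obs *\<^sub>v unit_vec (m - 1) (j - 1)) $ (j - 1)"
    using j' len by (intro scalar_prod_left_unit) auto
  then show ?thesis
    unfolding Let_def Obs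
    using info_gain_repeat[OF psd assms(2-4) j', of F] by (simp only: len)
qed

end
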